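(* Let $(S,M)$ be a bordered surface with marked points, $T$ an ideal triangulation of $(S,M)$ without self-folded triangles, and $\mathcal{A}(S,M)$ the associated cluster algebra with initial cluster $(x_1,\ldots,x_N)$ corresponding to $T$. Let $\gamma$ be a generalized arc, with labeled snake graph $\mathcal{G}_\gamma=\mathcal{G}[a_1,\ldots,a_n]$ (as unlabeled graphs, for a positive continued fraction $[a_1,\ldots,a_n]$ and corresponding choice of northeast edge $e_d$), and let $\gamma'$ and $L_1,\ldots,L_n$ be as in the context. Then in the field of fractions of $\mathcal{A}(S,M)$ \[\frac{x_\gamma}{x_{\gamma'}}=[L_1,L_2,\ldots,L_n]=L_1+\cfrac{1}{L_2+\cfrac{1}{\ddots+\cfrac{1}{L_n}}}.\] Moreover $x_\gamma$ and $x_{\gamma'}$ are relatively prime in the ring of Laurent polynomials $\mathbb{Z}[x_1^{\pm1},\ldots,x_N^{\pm1}]$, so the left-hand side is reduced. In particular, if $\gamma$ and $\gamma'$ have no self-crossings, then the left-hand side is a quotient of two cluster variables.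
   Context: Snake graphs: a tile is a square with sides parallel to the axes; a snake graph consists of tiles $G_1,\ldots,G_d$ where consecutive tiles share exactly one edge $e_i$, either north of $G_i$/south of $G_{i+1}$ or east of $G_i$/west of $G_{i+1}$; $e_0$ is the south edge of $G_1$, the southwest edges are the south and west edges of $G_1$, the northeast edges are the north and east edges of $G_d$. A sign function assigns $\pm$ to edges so that on each tile north and west agree, south and east agree, north and south differ. For positive integers $a_1,\ldots,a_n$, $\mathcal{G}[a_1,\ldots,a_n]$ is the snake graph with $d=\sum a_i-1$ tiles and a northeast edge $e_d$ such that $(f(e_0),\ldots,f(e_d))$ consists of $n$ constant blocks of lengths $a_1,\ldots,a_n$ with alternating signs. Let $\ell_i=a_1+\cdots+a_i$, $\ell_0=0$, and $\mathcal{H}_i$ the subsnake graph formed by tiles $G_{\ell_{i-1}+1},\ldots,G_{\ell_i-1}$ (for $i=n$: up to $G_d$), where an empty range $G_{j+1},\ldots,G_j$ means the single edge $e_j$. Generalized arcs and snake graphs: a generalized arc is a curve in $S$ up to isotopy with endpoints in $M$, otherwise disjoint from $M$ and $\partial S$, not cutting out an unpunctured monogon or bigon, possibly with self-crossings; an arc is a generalized arc without self-crossings. For $\gamma\notin T$ crossing $T$ (minimally) successively in arcs $\tau_{i_1},\ldots,\tau_{i_d}$, the labeled snake graph $\mathcal{G}_\gamma$ of Musiker–Schiffler–Williams has tiles $G_j$ = the quadrilateral of $T$ with diagonal $\tau_{i_j}$ (tile label $x_{i_j}$, edges labeled by the sides of the quadrilateral), consecutive tiles glued along the third side of the triangle of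 $T$ containing $\tau_{i_j},\tau_{i_{j+1}}$, with sign function on the interior edges determined by whether that side lies to the right or left of $\gamma$. Each edge $e$ has weight $x(e)=x_{\tau(e)}$ ($=1$ for boundary segments). For a labeled snake graph $\mathcal{H}$, $x(\mathcal{H})=\big(\sum_P\prod_{e\in P}x(e)\big)/\prod(\text{tile labels of }\mathcal{H})$, summing over perfect matchings $P$ (for a single edge, its weight); $x_\gamma:=x(\mathcal{G}_\gamma)$, which is the cluster variable of $\gamma$ when $\gamma$ is an arc. The Laurent polynomials: let $b_0$ be the southwest edge of $\mathcal{G}_\gamma$ other than $e_0$, $b_n$ the northeast edge other than $e_d$, and for $1\le i\le n-1$ let $b_i$ be the label of the tile $G_{\ell_i}$; write $b_i$ also for the corresponding weight. Define $L_1=x(\mathcal{H}_1)/b_1$, $L_2=x(\mathcal{H}_2)\,b_1/(b_0b_2)$, and in general $L_i=x(\mathcal{H}_i)\dfrac{b_0b_2^2b_4^2\cdots b_{i-3}^2b_{i-1}}{b_1^2b_3^2\cdots b_{i-2}^2b_i}$ for $i$ odd and $L_i=x(\mathcal{H}_i)\dfrac{b_1^2b_3^2\cdots b_{i-3}^2b_{i-1}}{b_0b_2^2\cdots b_{i-2}^2b_i}$ for $i$ even (so $L_3=x(\mathcal{H}_3)b_0b_2/(b_1^2b_3)$). The arc $\gamma'$: let $s$ be the starting point of $\gamma$ and $\Delta$ the first triangle of $T$ met by $\gamma$; let $\alpha$ be the side of $\Delta$ at $s$ corresponding to $e_0$ if $a_1=1$ and to $b_0$ if $a_1>1$, oriented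 to end at $s$; $\gamma'$ is the generalized arc $\gamma\circ\alpha$ (up to isotopy). Its snake graph is $\mathcal{G}_\gamma\setminus\mathcal{H}_1\cong\mathcal{G}[a_2,\ldots,a_n]$ and $x_{\gamma'}=x(\mathcal{G}_{\gamma'})$.
   Formalization: γ' is γ∘b_0 in all cases (with e_0 for a_1=1 the identity fails already for one tile with [1,1]); the cluster-variable clause excludes loops around one puncture (their x is a product of two cluster variables) and boundary segments, and uses the cited expansion theorem as a premise. *)

theory Defs
  imports Complex_Main "HOL-Library.Poly_Mapping" "HOL-Computational_Algebra.Fraction_Field"
begin

section \<open>Laurent polynomials and continued fractions\<close>

text \<open>
  A Laurent polynomial over the integers in the variables \<open>'v\<close> is a finitely supported
  family of coefficients indexed by integer exponent vectors.  The linear order on \<open>'v\<close> is only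
  there because the library needs it to show that this ring is an integral domain.
\<close>

type_synonym 'v laurent = "('v \<Rightarrow>\<^sub>0 int) \<Rightarrow>\<^sub>0 int"
type_synonym 'v ratfun = "'v laurent fract"

definition to_ratfun :: "'v::linorder laurent \<Rightarrow> 'v ratfun" where
  "to_ratfun p = Fract p 1"

definition var :: "'v::linorder \<Rightarrow> 'v ratfun" where
  "var v = to_ratfun (Poly_Mapping.single (Poly_Mapping.single v 1) 1)"

text \<open>
  The library constant \<open>coprime\<close> is restricted to rings with a division operation,
  so its definition is spelled out here.
\<close>

definition rel_prime :: "'a::comm_ring_1 \<Rightarrow> 'a \<Rightarrow> bool" where
  "rel_prime a b \<longleftrightarrow> (\<forall>c. c dvd a \<longrightarrow> c dvd b \<longrightarrow> c dvd 1)"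

fun cfrac :: "'a::field list \<Rightarrow> 'a" where
  "cfrac [] = 0"
| "cfrac [x] = x"
| "cfrac (x # y # zs) = x + 1 / cfrac (y # zs)"


section \<open>Labeled snake graphs\<close>

text \<open>
  Tiles are unit squares of the lattice, numbered from 1, the first one having its southwest
  corner at the origin.  The list \<open>st\<close> of steps, each \<open>North\<close> or \<open>East\<close>, says on which side of
  the \<open>j\<close>-th tile the next one is attached.  Edges are two-element sets of lattice points.
\<close>

datatype side = South | East | North | West

type_synonym edge = "(nat \<times> nat) set"

record 'w snake =
  steps :: "side list"
  edge_weight :: "edge \<Rightarrow> 'w"
  tile_label :: "nat \<Rightarrow> 'w"

definition num_tiles :: "'w snake \<Rightarrow> nat" where
  "num_tiles G = Suc (length (steps G))"

fun square_edge :: "nat \<times> nat \<Rightarrow> side \<Rightarrow> edge" where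
  "square_edge (x, y) South = {(x, y), (x + 1, y)}"
| "square_edge (x, y) East = {(x + 1, y), (x + 1, y + 1)}"
| "square_edge (x, y) North = {(x, y + 1), (x + 1, y + 1)}"
| "square_edge (x, y) West = {(x, y), (x, y + 1)}"

definition tile_edge :: "side list \<Rightarrow> nat \<Rightarrow> side \<Rightarrow> edge" where
  "tile_edge st j =
     square_edge (count_list (take (j - 1) st) East, count_list (take (j - 1) st) North)"

text \<open>
  The edges \<open>e\<^sub>0, \<dots>, e\<^sub>d\<close>.  The side \<open>ne\<close>, either \<open>North\<close> or \<open>East\<close>, is the choice of the
  northeast edge \<open>e\<^sub>d\<close> of the last tile.
\<close>

definition e_edge :: "side list \<Rightarrow> side \<Rightarrow> nat \<Rightarrow> edge" where
  "e_edge st ne j =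
     (if j = 0 then tile_edge st 1 South else tile_edge st j ((st @ [ne]) ! (j - 1)))"

definition other_ne :: "side \<Rightarrow> side" where
  "other_ne ne = (if ne = North then East else North)"

definition sign_function :: "side list \<Rightarrow> (edge \<Rightarrow> bool) \<Rightarrow> bool" where
  "sign_function st f \<longleftrightarrow>
     (\<forall>j\<in>{1..Suc (length st)}.
        f (tile_edge st j North) = f (tile_edge st j West) \<and>
        f (tile_edge st j South) = f (tile_edge st j East) \<and>
        f (tile_edge st j North) \<noteq> f (tile_edge st j South))"

text \<open>
  The snake graph with steps \<open>st\<close> and northeast edge \<open>ne\<close> is \<open>\<G>[a\<^sub>1, \<dots>, a\<^sub>n]\<close>.
\<close>

definition is_cf_snake :: "side list \<Rightarrow> side \<Rightarrow> nat list \<Rightarrow> bool" where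
  "is_cf_snake st ne as \<longleftrightarrow>
     set st \<subseteq> {North, East} \<and> ne \<in> {North, East} \<and> as \<noteq> [] \<and> (\<forall>a\<in>set as. a > 0) \<and>
     (\<exists>f. sign_function st f \<and>
          map (\<lambda>j. f (e_edge st ne j)) [0..<length st + 2] =
          concat (map (\<lambda>i. replicate (as ! i) (f (e_edge st ne 0) = even i)) [0..<length as]))"

text \<open>
  Edges of the subsnake graph formed by the tiles \<open>i, \<dots>, k\<close>; an empty range with \<open>i = k + 1\<close>
  means the single edge \<open>e\<^sub>k\<close>.
\<close>

definition subsnake :: "side list \<Rightarrow> side \<Rightarrow> nat \<Rightarrow> nat \<Rightarrow> edge set" where
  "subsnake st ne i k =
     (if k < i then {e_edge st ne k} else {tile_edge st j X | j X. j \<in> {i..k}})"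

definition perfect_matchings :: "edge set \<Rightarrow> edge set set" where
  "perfect_matchings E = {P. P \<subseteq> E \<and> (\<forall>v\<in>\<Union>E. \<exists>!e. e \<in> P \<and> v \<in> e)}"

definition x_subsnake :: "'w::field snake \<Rightarrow> side \<Rightarrow> nat \<Rightarrow> nat \<Rightarrow> 'w" where
  "x_subsnake G ne i k =
     (\<Sum>P\<in>perfect_matchings (subsnake (steps G) ne i k). \<Prod>e\<in>P. edge_weight G e) /
     (\<Prod>j\<in>{i..k}. tile_label G j)"

text \<open>The range of tiles is nonempty here, so the value of \<open>ne\<close> does not matter.\<close>

definition x_snake :: "'w::field snake \<Rightarrow> 'w" where
  "x_snake G = x_subsnake G North 1 (num_tiles G)"

definition ell :: "nat list \<Rightarrow> nat \<Rightarrow> nat" where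
  "ell as i = sum_list (take i as)"

definition x_H :: "'w::field snake \<Rightarrow> side \<Rightarrow> nat list \<Rightarrow> nat \<Rightarrow> 'w" where
  "x_H G ne as i = x_subsnake G ne (ell as (i - 1) + 1) (ell as i - 1)"

definition b_weight :: "'w::field snake \<Rightarrow> side \<Rightarrow> nat list \<Rightarrow> nat \<Rightarrow> 'w" where
  "b_weight G ne as i =
     (if i = 0 then edge_weight G (tile_edge (steps G) 1 West)
      else if i = length as then edge_weight G (tile_edge (steps G) (num_tiles G) (other_ne ne))
      else tile_label G (ell as i))"

text \<open>The first case is not an instance of the second: \<open>L\<^sub>1\<close> does not contain \<open>b\<^sub>0\<close>.\<close>

definition L_poly :: "'w::field snake \<Rightarrow> side \<Rightarrow> nat list \<Rightarrow> nat \<Rightarrow> 'w" where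
  "L_poly G ne as i =
     (let b = b_weight G ne as in
      if i = 1 then x_H G ne as 1 / b 1
      else if odd i then
        x_H G ne as i *
          (b 0 * (\<Prod>k\<in>{k\<in>{2..i - 3}. even k}. (b k)\<^sup>2) * b (i - 1)) /
          ((\<Prod>k\<in>{k\<in>{1..i - 2}. odd k}. (b k)\<^sup>2) * b i)
      else
        x_H G ne as i *
          ((\<Prod>k\<in>{k\<in>{1..i - 3}. odd k}. (b k)\<^sup>2) * b (i - 1)) /
          (b 0 * (\<Prod>k\<in>{k\<in>{2..i - 2}. even k}. (b k)\<^sup>2) * b i))"


section \<open>Triangulated surfaces and generalized arcs\<close>

text \<open>
  An ideal triangulation of an oriented bordered surface with marked points, given by its
  triangles and their gluing.  The elements of \<open>'h\<close> are the sides of the triangles, each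
  oriented counterclockwise along the boundary of its triangle; \<open>nxt\<close> is the counterclockwise
  successor in the same triangle.  The label of a side is \<open>Some v\<close> if it is the arc \<open>v\<close> and
  \<open>None\<close> if it is a boundary segment.  The two sides labeled \<open>v\<close> are glued, reversing
  orientation.  Marked points are the vertices of the glued complex.

  A triangle two of whose sides are glued to each other is self-folded, because an oriented
  gluing folds the two sides onto each other around their common vertex.
\<close>

record ('h, 'v) triangulation =
  nxt :: "'h \<Rightarrow> 'h"
  lab :: "'h \<Rightarrow> 'v option"

definition prv :: "('h, 'v) triangulation \<Rightarrow> 'h \<Rightarrow> 'h" where
  "prv T h = nxt T (nxt T h)"

definition ideal_triangulation :: "('h::finite, 'v::finite) triangulation \<Rightarrow> bool" where
  "ideal_triangulation T \<longleftrightarrow>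
     (\<forall>h. nxt T h \<noteq> h \<and> nxt T (nxt T (nxt T h)) = h) \<and>
     (\<forall>v. card {h. lab T h = Some v} = 2) \<and>
     (\<forall>h h'. (h, h') \<in> {(g, g'). g' = nxt T g \<or> lab T g \<noteq> None \<and> lab T g' = lab T g}\<^sup>*)"

definition no_self_folded :: "('h, 'v) triangulation \<Rightarrow> bool" where
  "no_self_folded T \<longleftrightarrow> (\<forall>h. lab T h \<noteq> None \<longrightarrow> lab T (nxt T h) \<noteq> lab T h)"

text \<open>The other side glued to \<open>h\<close>; only meaningful if \<open>h\<close> is not a boundary segment.\<close>

definition opp :: "('h, 'v) triangulation \<Rightarrow> 'h \<Rightarrow> 'h" where
  "opp T h = (THE h'. h' \<noteq> h \<and> lab T h' = lab T h)"

text \<open>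
  Isotopy classes of curves between marked points.  \<open>Side h\<close> is the side \<open>h\<close> itself.
  \<open>Crossing [h\<^sub>1, \<dots>, h\<^sub>d]\<close> is the curve that starts at the vertex opposite to \<open>h\<^sub>1\<close> in the triangle
  \<open>\<Delta>\<^sub>0\<close> of \<open>h\<^sub>1\<close>, leaves \<open>\<Delta>\<^sub>j\<^sub>-\<^sub>1\<close> through its side \<open>h\<^sub>j\<close>, thereby entering the triangle \<open>\<Delta>\<^sub>j\<close> of
  \<open>opp h\<^sub>j\<close>, and ends at the vertex of \<open>\<Delta>\<^sub>d\<close> opposite to \<open>opp h\<^sub>d\<close>.  It crosses the triangulation
  minimally iff it never leaves a triangle through the side by which it entered.  The generalized
  arcs that do not belong to the triangulation correspond to the minimal crossing sequences of
  positive length; such a curve never cuts out an unpunctured monogon or bigon.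
\<close>

datatype 'h curve = Side 'h | Crossing "'h list"

definition crossing_sequence :: "('h, 'v) triangulation \<Rightarrow> 'h list \<Rightarrow> bool" where
  "crossing_sequence T hs \<longleftrightarrow>
     hs \<noteq> [] \<and> (\<forall>h\<in>set hs. lab T h \<noteq> None) \<and>
     (\<forall>j. Suc j < length hs \<longrightarrow>
        hs ! Suc j \<in> {nxt T (opp T (hs ! j)), prv T (opp T (hs ! j))})"

fun generalized_arc :: "('h, 'v) triangulation \<Rightarrow> 'h curve \<Rightarrow> bool" where
  "generalized_arc T (Side h) \<longleftrightarrow> lab T h \<noteq> None"
| "generalized_arc T (Crossing hs) \<longleftrightarrow> crossing_sequence T hs"

text \<open>
  A corner of a triangle is given by the side \<open>c\<close> of that triangle which starts there.
  \<open>from_corner T t c hs\<close> is the isotopy class of the curve that starts at the corner \<open>c\<close>,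
  leaves successive triangles through the sides \<open>hs\<close> and ends at the corner \<open>t\<close> of the last
  triangle.  If the first side to be crossed is incident to the corner, then the crossing is
  removed by pulling the curve over to the corresponding corner of the next triangle.
  If nothing remains to be crossed, then the curve is isotopic to the side joining \<open>c\<close> and \<open>t\<close>.
\<close>

fun from_corner :: "('h, 'v) triangulation \<Rightarrow> 'h \<Rightarrow> 'h \<Rightarrow> 'h list \<Rightarrow> 'h curve" where
  "from_corner T t c [] = (if t = nxt T c then Side c else Side (prv T c))"
| "from_corner T t c (h # hs) =
     (if h = c then from_corner T t (nxt T (opp T h)) hs
      else if h = prv T c then from_corner T t (opp T h) hs
      else Crossing (h # hs))"

text \<open>
  The composition of the curve \<open>Crossing hs\<close>, starting at \<open>s\<close>, with the side \<open>\<alpha>\<close> of its first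
  triangle oriented to end at \<open>s\<close>.  Of the two sides at \<open>s\<close>, \<open>prv h\<^sub>1\<close> starts and \<open>nxt h\<^sub>1\<close> ends there.
\<close>

definition compose_side :: "('h, 'v) triangulation \<Rightarrow> 'h list \<Rightarrow> 'h \<Rightarrow> 'h curve" where
  "compose_side T hs \<alpha> =
     from_corner T (prv T (opp T (last hs))) (if \<alpha> = prv T (hd hs) then hd hs else \<alpha>) hs"


section \<open>The labeled snake graph of a generalized arc\<close>

definition label_weight :: "'v::linorder option \<Rightarrow> 'v ratfun" where
  "label_weight l = (case l of None \<Rightarrow> 1 | Some v \<Rightarrow> var v)"

text \<open>
  The tile of a crossing \<open>h\<close> is the quadrilateral with diagonal \<open>h\<close>, drawn with its diagonal
  running from northwest to southeast and the triangle that the curve leaves in the southwest.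
  It can be drawn with the orientation of the surface (\<open>rel\<close> true) or mirrored.
\<close>

fun tile_side :: "('h, 'v) triangulation \<Rightarrow> bool \<Rightarrow> 'h \<Rightarrow> side \<Rightarrow> 'h" where
  "tile_side T rel h South = (if rel then prv T h else nxt T h)"
| "tile_side T rel h West = (if rel then nxt T h else prv T h)"
| "tile_side T rel h East = (if rel then nxt T (opp T h) else prv T (opp T h))"
| "tile_side T rel h North = (if rel then prv T (opp T h) else nxt T (opp T h))"

text \<open>
  Orientations of consecutive tiles alternate.  The orientation \<open>r\<close> of the first tile is a free
  choice; the two choices give mirror images of the same labeled graph.  Two consecutive tiles
  are glued along the side of their common triangle that the curve does not cross.
\<close>

definition arc_steps :: "('h, 'v) triangulation \<Rightarrow> bool \<Rightarrow> 'h list \<Rightarrow> side list" where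
  "arc_steps T r hs =
     map (\<lambda>j. if tile_side T (r = odd j) (hs ! (j - 1)) North = hs ! j then East else North)
       [1..<length hs]"

definition arc_edge_label :: "('h, 'v) triangulation \<Rightarrow> bool \<Rightarrow> 'h list \<Rightarrow> edge \<Rightarrow> 'v option" where
  "arc_edge_label T r hs e =
     (THE l. \<exists>j\<in>{1..length hs}. \<exists>X. e = tile_edge (arc_steps T r hs) j X \<and>
                l = lab T (tile_side T (r = odd j) (hs ! (j - 1)) X))"

definition arc_snake ::
    "('h, 'v::linorder) triangulation \<Rightarrow> bool \<Rightarrow> 'h list \<Rightarrow> 'v ratfun snake" where
  "arc_snake T r hs =
     \<lparr> steps = arc_steps T r hs,
       edge_weight = (\<lambda>e. label_weight (arc_edge_label T r hs e)),
       tile_label = (\<lambda>j. label_weight (lab T (hs ! (j - 1)))) \<rparr>"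

fun x_curve :: "('h, 'v::linorder) triangulation \<Rightarrow> 'h curve \<Rightarrow> 'v ratfun" where
  "x_curve T (Side h) = label_weight (lab T h)"
| "x_curve T (Crossing hs) = x_snake (arc_snake T True hs)"

text \<open>
  The composition of \<open>Crossing hs\<close> with the side of its first triangle that corresponds to the
  southwest edge \<open>b\<^sub>0\<close> of the snake graph.  This is the right side also if \<open>a\<^sub>1 = 1\<close>: by the Ptolemy
  relation in the first tile, \<open>x\<^sub>\<gamma>\<close> times the label of that tile is the weight of \<open>e\<^sub>0\<close> times
  the composition with \<open>b\<^sub>0\<close> plus the weight of \<open>b\<^sub>0\<close> times the composition with \<open>e\<^sub>0\<close>, and
  \<open>L\<^sub>1 = x(e\<^sub>0) / b\<^sub>1\<close>.  Only the composition with \<open>b\<^sub>0\<close> has the snake graph \<open>\<G>\<^sub>\<gamma> \ \<H>\<^sub>1\<close>.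
\<close>

definition gamma' :: "('h, 'v) triangulation \<Rightarrow> bool \<Rightarrow> 'h list \<Rightarrow> 'h curve" where
  "gamma' T r hs = compose_side T hs (tile_side T r (hd hs) West)"


section \<open>Self-crossings and arcs\<close>

text \<open>
  A curve \<open>Crossing hs\<close> consists of chords, one in each triangle \<open>\<Delta>\<^sub>0, \<dots>, \<Delta>\<^sub>d\<close> that it visits.
  A point on the boundary of a triangle is a pair of a side and a parameter in \<open>[0, 1)\<close> along it.
  The curve has no self-crossings if its crossing points with the triangulation can be placed,
  at the parameter \<open>p j\<close> on \<open>hs ! j\<close>, such that no two chords in the same triangle cross.
  Chords may share an endpoint that is a vertex.
\<close>

definition chord_start ::
    "('h, 'v) triangulation \<Rightarrow> 'h list \<Rightarrow> (nat \<Rightarrow> real) \<Rightarrow> nat \<Rightarrow> 'h \<times> real" where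
  "chord_start T hs p k =
     (if k = 0 then (prv T (hd hs), 0) else (opp T (hs ! (k - 1)), 1 - p (k - 1)))"

definition chord_end ::
    "('h, 'v) triangulation \<Rightarrow> 'h list \<Rightarrow> (nat \<Rightarrow> real) \<Rightarrow> nat \<Rightarrow> 'h \<times> real" where
  "chord_end T hs p k =
     (if k = length hs then (prv T (opp T (last hs)), 0) else (hs ! k, p k))"

text \<open>Position of a point on the boundary of a triangle, counted counterclockwise from side \<open>c\<close>.\<close>

definition boundary_pos :: "('h, 'v) triangulation \<Rightarrow> 'h \<Rightarrow> 'h \<times> real \<Rightarrow> real" where
  "boundary_pos T c q =
     (if fst q = c then 0 else if fst q = nxt T c then 1 else 2) + snd q"

definition interleaved :: "real \<Rightarrow> real \<Rightarrow> real \<Rightarrow> real \<Rightarrow> bool" where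
  "interleaved a b c d \<longleftrightarrow>
     (min a b < c \<and> c < max a b \<and> (d < min a b \<or> max a b < d)) \<or>
     (min a b < d \<and> d < max a b \<and> (c < min a b \<or> max a b < c))"

definition chords_cross ::
    "('h, 'v) triangulation \<Rightarrow> 'h list \<Rightarrow> (nat \<Rightarrow> real) \<Rightarrow> nat \<Rightarrow> nat \<Rightarrow> bool" where
  "chords_cross T hs p k m \<longleftrightarrow>
     (let c = fst (chord_start T hs p k) in
      fst (chord_start T hs p m) \<in> {c, nxt T c, prv T c} \<and>
      interleaved
        (boundary_pos T c (chord_start T hs p k)) (boundary_pos T c (chord_end T hs p k))
        (boundary_pos T c (chord_start T hs p m)) (boundary_pos T c (chord_end T hs p m)))"

fun no_self_crossings :: "('h, 'v) triangulation \<Rightarrow> 'h curve \<Rightarrow> bool" where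
  "no_self_crossings T (Side h) \<longleftrightarrow> True"
| "no_self_crossings T (Crossing hs) \<longleftrightarrow>
     (\<exists>p. (\<forall>j<length hs. 0 < p j \<and> p j < 1) \<and>
          (\<forall>j<length hs. \<forall>k<length hs. j \<noteq> k \<longrightarrow>
             (hs ! j, p j) \<noteq> (hs ! k, p k) \<and> (hs ! j, p j) \<noteq> (opp T (hs ! k), 1 - p k)) \<and>
          (\<forall>k\<le>length hs. \<forall>m\<le>length hs. \<not> chords_cross T hs p k m))"

text \<open>
  Loops that cut out a once-punctured monogon.  They have no self-crossings, but the element
  attached to such a loop is a product of two cluster variables (those of the plain and of the
  notched radius inside the monogon), so they are not arcs in the sense of cluster variables.

  \<open>turn\<close> rotates a corner counterclockwise around its vertex; \<open>puncture_at T c k\<close> says that the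
  vertex at corner \<open>c\<close> is a puncture with \<open>k\<close> corners.  The loop follows a curve to the puncture,
  goes around it and returns; that curve is either the side \<open>c\<close> or crosses the triangulation in \<open>u\<close>.
\<close>

definition turn :: "('h, 'v) triangulation \<Rightarrow> 'h \<Rightarrow> 'h" where
  "turn T c = opp T (prv T c)"

definition puncture_at :: "('h, 'v) triangulation \<Rightarrow> 'h \<Rightarrow> nat \<Rightarrow> bool" where
  "puncture_at T c k \<longleftrightarrow>
     k > 0 \<and> (turn T ^^ k) c = c \<and> (\<forall>i. 0 < i \<and> i < k \<longrightarrow> (turn T ^^ i) c \<noteq> c) \<and>
     (\<forall>i<k. lab T (prv T ((turn T ^^ i) c)) \<noteq> None)"

definition around :: "('h, 'v) triangulation \<Rightarrow> 'h \<Rightarrow> nat \<Rightarrow> 'h list" where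
  "around T c m = map (\<lambda>i. prv T ((turn T ^^ i) c)) [0..<m]"

definition ccw_punctured_loop :: "('h, 'v) triangulation \<Rightarrow> 'h list \<Rightarrow> bool" where
  "ccw_punctured_loop T hs \<longleftrightarrow>
     (\<exists>c k. puncture_at T c k \<and>
        (hs = around T c (k - 1) \<or>
         (\<exists>u. crossing_sequence T u \<and> c = prv T (opp T (last u)) \<and>
              hs = u @ around T c k @ rev (map (opp T) u))))"

fun punctured_loop :: "('h, 'v) triangulation \<Rightarrow> 'h curve \<Rightarrow> bool" where
  "punctured_loop T (Side h) \<longleftrightarrow> False"
| "punctured_loop T (Crossing hs) \<longleftrightarrow>
     ccw_punctured_loop T hs \<or> ccw_punctured_loop T (rev (map (opp T) hs))"

definition is_arc :: "('h, 'v) triangulation \<Rightarrow> 'h curve \<Rightarrow> bool" where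
  "is_arc T \<gamma> \<longleftrightarrow> generalized_arc T \<gamma> \<and> no_self_crossings T \<gamma> \<and> \<not> punctured_loop T \<gamma>"


section \<open>The cluster algebra of a triangulated surface\<close>

text \<open>
  Coefficient-free seeds inside the field of rational functions in the initial cluster, which is
  the field of fractions of the cluster algebra.
\<close>

type_synonym 'v seed = "('v \<Rightarrow> 'v \<Rightarrow> int) \<times> ('v \<Rightarrow> 'v ratfun)"

fun mutate :: "'v \<Rightarrow> 'v::{finite,linorder} seed \<Rightarrow> 'v seed" where
  "mutate k (B, x) =
     ((\<lambda>i j. if i = k \<or> j = k then - B i j
             else B i j + (\<bar>B i k\<bar> * B k j + B i k * \<bar>B k j\<bar>) div 2),
      x(k := ((\<Prod>i\<in>UNIV. x i ^ nat (B i k)) + (\<Prod>i\<in>UNIV. x i ^ nat (- B i k))) / x k))"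

text \<open>Signed adjacency matrix; correct as it stands only without self-folded triangles.\<close>

definition adjacency_matrix :: "('h::finite, 'v) triangulation \<Rightarrow> 'v \<Rightarrow> 'v \<Rightarrow> int" where
  "adjacency_matrix T i j =
     int (card {h. lab T h = Some j \<and> lab T (nxt T h) = Some i}) -
     int (card {h. lab T h = Some i \<and> lab T (nxt T h) = Some j})"

inductive_set seeds :: "('h::finite, 'v::{finite,linorder}) triangulation \<Rightarrow> 'v seed set"
  for T where
  initial: "(adjacency_matrix T, var) \<in> seeds T"
| step: "s \<in> seeds T \<Longrightarrow> mutate k s \<in> seeds T"

definition cluster_variables ::
    "('h::finite, 'v::{finite,linorder}) triangulation \<Rightarrow> 'v ratfun set" where
  "cluster_variables T = {x v | B x v. (B, x) \<in> seeds T}"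

text \<open>
  The expansion theorem of Musiker, Schiffler and Williams for plain arcs: the Laurent polynomial
  of the snake graph of an arc is a cluster variable.
\<close>

definition expansion_formula :: "('h::finite, 'v::{finite,linorder}) triangulation \<Rightarrow> bool" where
  "expansion_formula T \<longleftrightarrow> (\<forall>\<delta>. is_arc T \<delta> \<longrightarrow> x_curve T \<delta> \<in> cluster_variables T)"

end

theory Submission
  imports Defs
begin

text \<open>
  Removing tiles from the southwest end turns the sum over perfect matchings of a snake graph into
  a recurrence of Ptolemy relations for the curves joining the vertices of the triangles crossed by
  \<open>\<gamma>\<close> to its endpoint.  The constant blocks of the sign sequence are the maximal fans of diagonals
  with a common vertex.  Let \<open>F\<^sub>i\<close> be the Laurent polynomial of the curve from the center of the
  \<open>i\<close>-th fan to the endpoint of \<open>\<gamma>\<close>, so that \<open>F\<^sub>0 = x\<^sub>\<gamma>\<close> and \<open>F\<^sub>1\<close> belongs to \<open>\<gamma>'\<close>.  Telescoping the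
  Ptolemy relations along a fan gives \<open>b\<^sub>i F\<^sub>i\<^sub>-\<^sub>1 = x(\<H>\<^sub>i) F\<^sub>i + b\<^sub>i\<^sub>-\<^sub>1 F\<^sub>i\<^sub>+\<^sub>1\<close> with \<open>F\<^sub>n = b\<^sub>n\<close> and
  \<open>F\<^sub>n\<^sub>+\<^sub>1 = 0\<close>, which is the continued fraction up to rescaling.  No \<open>F\<^sub>i\<close> vanishes, as its
  coefficients are nonnegative, and all labels are units of the Laurent ring, so a common divisor of
  \<open>F\<^sub>0\<close> and \<open>F\<^sub>1\<close> divides all Ptolemy lengths down to a unit.
\<close>

section \<open>Matching sums of lattice regions\<close>

definition lattice_edge :: "edge \<Rightarrow> bool" where
  "lattice_edge e \<longleftrightarrow> (\<exists>x y. e = {(x, y), (x + 1, y)} \<or> e = {(x, y), (x, y + 1)})"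

text \<open>A region is given by its vertices alone, and every lattice edge inside it is allowed.
  Choosing an edge then only deletes its endpoints, so all regions met on the way have the same
  form.\<close>

definition exact_matchings :: "(nat \<times> nat) set \<Rightarrow> edge set set" where
  "exact_matchings V =
     {P. (\<forall>e\<in>P. lattice_edge e \<and> e \<subseteq> V) \<and> (\<forall>v\<in>V. \<exists>!e. e \<in> P \<and> v \<in> e)}"

definition matching_sum :: "(edge \<Rightarrow> 'w::field) \<Rightarrow> (nat \<times> nat) set \<Rightarrow> 'w" where
  "matching_sum w V = (\<Sum>P\<in>exact_matchings V. \<Prod>e\<in>P. w e)"

lemma lattice_edge_nonempty: "lattice_edge e \<Longrightarrow> e \<noteq> {}"
  by (auto simp: lattice_edge_def)

lemma finite_exact_matchings: "finite V \<Longrightarrow> finite (exact_matchings V)"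
  by (rule finite_subset[of _ "Pow (Pow V)"]) (auto simp: exact_matchings_def)

lemma finite_exact_matching: "finite V \<Longrightarrow> P \<in> exact_matchings V \<Longrightarrow> finite P"
  by (rule finite_subset[of _ "Pow V"]) (auto simp: exact_matchings_def)

lemma exact_matchings_empty: "exact_matchings {} = {{}}"
  using lattice_edge_nonempty by (fastforce simp: exact_matchings_def)

lemma matching_sum_empty: "matching_sum w {} = 1"
  by (simp add: matching_sum_def exact_matchings_empty)

lemma exact_matching_remove:
  assumes "P \<in> exact_matchings V" "e \<in> P"
  shows "P - {e} \<in> exact_matchings (V - e)"
proof -
  have sub: "\<forall>f\<in>P. lattice_edge f \<and> f \<subseteq> V" and cov: "\<forall>v\<in>V. \<exists>!f. f \<in> P \<and> v \<in> f"
    using assms(1) by (auto simp: exact_matchings_def)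
  have "f \<inter> e = {}" if "f \<in> P" "f \<noteq> e" for f
    using that sub cov assms(2) by blast
  then have "\<forall>f\<in>P - {e}. lattice_edge f \<and> f \<subseteq> V - e"
    using sub by blast
  moreover have "\<exists>!f. f \<in> P - {e} \<and> v \<in> f" if "v \<in> V - e" for v
  proof -
    have "\<exists>!f. f \<in> P \<and> v \<in> f" using cov that by blast
    then show ?thesis using that by auto
  qed
  ultimately show ?thesis by (simp add: exact_matchings_def)
qed

lemma exact_matching_insert:
  assumes "P \<in> exact_matchings (V - e)" "lattice_edge e" "e \<subseteq> V"
  shows "insert e P \<in> exact_matchings V"
proof -
  have sub: "\<forall>f\<in>P. lattice_edge f \<and> f \<subseteq> V - e"
    and cov: "\<forall>v\<in>V - e. \<exists>!f. f \<in> P \<and> v \<in> f"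
    using assms(1) by (auto simp: exact_matchings_def)
  have "\<exists>!f. f \<in> insert e P \<and> v \<in> f" if "v \<in> V" for v
  proof (cases "v \<in> e")
    case True
    then show ?thesis using sub by blast
  next
    case False
    then have "\<exists>!f. f \<in> P \<and> v \<in> f" using cov that by blast
    then show ?thesis using False by auto
  qed
  then show ?thesis using sub assms(2,3) by (auto simp: exact_matchings_def)
qed

text \<open>Each matching has exactly one edge at \<open>v\<close>, and deleting that edge is a
  bijection onto the matchings of the remaining region.\<close>

lemma matching_sum_expand:
  assumes fin: "finite V" and v: "v \<in> V"
    and N: "N = {e. lattice_edge e \<and> v \<in> e \<and> e \<subseteq> V}"
  shows "matching_sum w V = (\<Sum>e\<in>N. w e * matching_sum w (V - e))"
proof -
  have finN: "finite N"
    by (rule finite_subset[of _ "Pow V"]) (use N fin in auto)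
  have notin: "e \<notin> P" if "e \<in> N" "P \<in> exact_matchings (V - e)" for e P
    using that lattice_edge_nonempty by (auto simp: N exact_matchings_def)
  have decomp: "exact_matchings V = (\<Union>e\<in>N. insert e ` exact_matchings (V - e))"
  proof (intro set_eqI iffI)
    fix P assume P: "P \<in> exact_matchings V"
    then obtain e where e: "e \<in> P" "v \<in> e"
      using v by (auto simp: exact_matchings_def)
    then have "e \<in> N" using P by (auto simp: exact_matchings_def N)
    moreover have "P = insert e (P - {e})" using e by blast
    ultimately show "P \<in> (\<Union>e\<in>N. insert e ` exact_matchings (V - e))"
      using exact_matching_remove[OF P e(1)] by blast
  qed (auto simp: N intro: exact_matching_insert)
  have disj: "insert e ` exact_matchings (V - e) \<inter> insert f ` exact_matchings (V - f) = {}"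
    if "e \<in> N" "f \<in> N" "e \<noteq> f" for e f
  proof -
    have "f \<notin> P" if "P \<in> exact_matchings (V - e)" for P
      using that \<open>f \<in> N\<close> \<open>e \<in> N\<close> by (auto simp: N exact_matchings_def)
    then show ?thesis using \<open>e \<noteq> f\<close> by blast
  qed
  have inj: "inj_on (insert e) (exact_matchings (V - e))" if "e \<in> N" for e
    using notin[OF that] by (intro inj_onI) (metis insert_ident)
  have "matching_sum w V =
      (\<Sum>e\<in>N. \<Sum>P\<in>insert e ` exact_matchings (V - e). \<Prod>f\<in>P. w f)"
    unfolding matching_sum_def decomp
    using finN fin disj by (intro sum.UNION_disjoint) (auto intro: finite_exact_matchings)
  also have "\<dots> = (\<Sum>e\<in>N. w e * matching_sum w (V - e))"
  proof (rule sum.cong[OF refl])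
    fix e assume e: "e \<in> N"
    have "(\<Sum>P\<in>insert e ` exact_matchings (V - e). \<Prod>f\<in>P. w f)
        = (\<Sum>P\<in>exact_matchings (V - e). \<Prod>f\<in>insert e P. w f)"
      using inj[OF e] by (simp add: sum.reindex)
    also have "\<dots> = (\<Sum>P\<in>exact_matchings (V - e). w e * (\<Prod>f\<in>P. w f))"
      using notin[OF e] fin
      by (intro sum.cong[OF refl] prod.insert) (auto intro: finite_exact_matching[of "V - e"])
    finally show "(\<Sum>P\<in>insert e ` exact_matchings (V - e). \<Prod>f\<in>P. w f)
        = w e * matching_sum w (V - e)"
      by (simp add: matching_sum_def sum_distrib_left)
  qed
  finally show ?thesis .
qed

section \<open>Vertex regions of snake graphs and removal of the first tile\<close>

fun snake_vertices :: "nat \<times> nat \<Rightarrow> side list \<Rightarrow> (nat \<times> nat) set" where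
  "snake_vertices (x, y) [] = {(x, y), (x + 1, y), (x, y + 1), (x + 1, y + 1)}"
| "snake_vertices (x, y) (s # st) =
     (if s = East then {(x, y), (x, y + 1)} \<union> snake_vertices (x + 1, y) st
      else {(x, y), (x + 1, y)} \<union> snake_vertices (x, y + 1) st)"

lemma finite_snake_vertices: "finite (snake_vertices p st)"
  by (induction p st rule: snake_vertices.induct) auto

lemma snake_vertices_ge: "(a, b) \<in> snake_vertices (x, y) st \<Longrightarrow> x \<le> a \<and> y \<le> b"
  by (induction "(x, y)" st arbitrary: x y rule: snake_vertices.induct)
    (fastforce split: if_splits)+

lemma snake_vertices_corners:
  "(x, y) \<in> snake_vertices (x, y) st" "(x + 1, y) \<in> snake_vertices (x, y) st"
  "(x, y + 1) \<in> snake_vertices (x, y) st" "(x + 1, y + 1) \<in> snake_vertices (x, y) st"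
proof -
  have "{(x, y), (x + 1, y), (x, y + 1), (x + 1, y + 1)} \<subseteq> snake_vertices (x, y) st"
    by (induction "(x, y)" st arbitrary: x y rule: snake_vertices.induct) auto
  then show "(x, y) \<in> snake_vertices (x, y) st" "(x + 1, y) \<in> snake_vertices (x, y) st"
    "(x, y + 1) \<in> snake_vertices (x, y) st" "(x + 1, y + 1) \<in> snake_vertices (x, y) st"
    by auto
qed

text \<open>A point on an axis has no left or lower neighbour; the witnesses \<open>x'\<close> and
  \<open>y'\<close> express this without truncated subtraction.\<close>

lemma lattice_edges_at:
  "{e. lattice_edge e \<and> (x, y) \<in> e \<and> e \<subseteq> V} =
   {e. (x, y) \<in> V \<and> (e = {(x, y), (x + 1, y)} \<and> (x + 1, y) \<in> V \<or>
        e = {(x, y), (x, y + 1)} \<and> (x, y + 1) \<in> V \<or>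
        (\<exists>x'. x = x' + 1 \<and> e = {(x', y), (x, y)} \<and> (x', y) \<in> V) \<or>
        (\<exists>y'. y = y' + 1 \<and> e = {(x, y'), (x, y)} \<and> (x, y') \<in> V))}"
  unfolding lattice_edge_def by auto

lemma matching_sum_pendant:
  assumes fin: "finite V" and v: "v \<in> V" and u: "u \<in> V"
    and e: "{e. lattice_edge e \<and> v \<in> e \<and> e \<subseteq> V} = {{v, u}}"
  shows "matching_sum w V = w {v, u} * matching_sum w (V - {v, u})"
  using matching_sum_expand[OF fin v refl, of w] by (simp add: e)

lemma square_edge_neq:
  "{(x, y), (x + 1, y)} \<noteq> {(x, y), (x, y + (1::nat))}" for x y :: nat
  by (auto simp: doubleton_eq_iff)

text \<open>Nothing of the snake lies to the left of or below its first corner, so only the south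
  and the west side can cover it.\<close>

lemma matching_sum_snake:
  "matching_sum w (snake_vertices (x, y) st) =
     w (square_edge (x, y) South) * matching_sum w (snake_vertices (x, y) st - square_edge (x, y) South) +
     w (square_edge (x, y) West) * matching_sum w (snake_vertices (x, y) st - square_edge (x, y) West)"
proof -
  let ?V = "snake_vertices (x, y) st"
  have "{e. lattice_edge e \<and> (x, y) \<in> e \<and> e \<subseteq> ?V} = {square_edge (x, y) South, square_edge (x, y) West}"
    unfolding lattice_edges_at
    using snake_vertices_corners[of x y st] by (auto dest: snake_vertices_ge)
  then show ?thesis
    using matching_sum_expand[OF finite_snake_vertices snake_vertices_corners(1)[of x y st] refl, of w]
      square_edge_neq[of x y] by simp
qed

lemma matching_sum_snake_Nil:
  "matching_sum w (snake_vertices (x, y) [] - square_edge (x, y) South) = w (square_edge (x, y) North)"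
  "matching_sum w (snake_vertices (x, y) [] - square_edge (x, y) West) = w (square_edge (x, y) East)"
proof -
  have V: "snake_vertices (x, y) [] - square_edge (x, y) South = {(x, y + 1), (x + 1, y + 1)}"
    "snake_vertices (x, y) [] - square_edge (x, y) West = {(x + 1, y), (x + 1, y + 1)}" by auto
  show "matching_sum w (snake_vertices (x, y) [] - square_edge (x, y) South) = w (square_edge (x, y) North)"
    unfolding V
    by (subst matching_sum_pendant[of _ "(x, y + 1)" "(x + 1, y + 1)"])
      (auto simp: lattice_edges_at matching_sum_empty)
  show "matching_sum w (snake_vertices (x, y) [] - square_edge (x, y) West) = w (square_edge (x, y) East)"
    unfolding V
    by (subst matching_sum_pendant[of _ "(x + 1, y)" "(x + 1, y + 1)"])
      (auto simp: lattice_edges_at matching_sum_empty)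
qed

text \<open>Without the west side exactly the rest of the snake remains. Without the south side the
  northwest corner keeps only the north side, which is forced, so that the next tile loses both ends
  of its west side.\<close>

lemma matching_sum_snake_East:
  "matching_sum w (snake_vertices (x, y) (East # st) - square_edge (x, y) West) =
     matching_sum w (snake_vertices (x + 1, y) st)" (is ?B)
  "matching_sum w (snake_vertices (x, y) (East # st) - square_edge (x, y) South) =
     w (square_edge (x, y) North) *
     matching_sum w (snake_vertices (x + 1, y) st - square_edge (x + 1, y) West)" (is ?A)
proof -
  let ?V = "snake_vertices (x + 1, y) st"
  have notin: "(x, b) \<notin> ?V" for b by (auto dest: snake_vertices_ge)
  have "snake_vertices (x, y) (East # st) - square_edge (x, y) West = ?V"
    using notin by auto
  then show ?B by simp
  have V: "snake_vertices (x, y) (East # st) - square_edge (x, y) South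
      = insert (x, y + 1) (?V - {(x + 1, y)})"
    using notin by auto
  have "{e. lattice_edge e \<and> (x, y + 1) \<in> e \<and> e \<subseteq> insert (x, y + 1) (?V - {(x + 1, y)})}
      = {{(x, y + 1), (x + 1, y + 1)}}"
    unfolding lattice_edges_at using snake_vertices_corners[of "x + 1" y st] notin
    by (auto dest: snake_vertices_ge)
  moreover have "insert (x, y + 1) (?V - {(x + 1, y)}) - {(x, y + 1), (x + 1, y + 1)}
      = ?V - square_edge (x + 1, y) West"
    using notin by auto
  ultimately show ?A
    unfolding V using snake_vertices_corners[of "x + 1" y st]
    by (subst matching_sum_pendant[of _ "(x, y + 1)" "(x + 1, y + 1)"])
      (auto simp: finite_snake_vertices)
qed

lemma matching_sum_snake_North:
  "matching_sum w (snake_vertices (x, y) (North # st) - square_edge (x, y) South) =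
     matching_sum w (snake_vertices (x, y + 1) st)" (is ?A)
  "matching_sum w (snake_vertices (x, y) (North # st) - square_edge (x, y) West) =
     w (square_edge (x, y) East) *
     matching_sum w (snake_vertices (x, y + 1) st - square_edge (x, y + 1) South)" (is ?B)
proof -
  let ?V = "snake_vertices (x, y + 1) st"
  have notin: "(a, y) \<notin> ?V" for a by (auto dest: snake_vertices_ge)
  have "snake_vertices (x, y) (North # st) - square_edge (x, y) South = ?V"
    using notin by auto
  then show ?A by simp
  have V: "snake_vertices (x, y) (North # st) - square_edge (x, y) West
      = insert (x + 1, y) (?V - {(x, y + 1)})"
    using notin by auto
  have "{e. lattice_edge e \<and> (x + 1, y) \<in> e \<and> e \<subseteq> insert (x + 1, y) (?V - {(x, y + 1)})}
      = {{(x + 1, y), (x + 1, y + 1)}}"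
    unfolding lattice_edges_at using snake_vertices_corners[of x "y + 1" st] notin
    by (auto dest: snake_vertices_ge)
  moreover have "insert (x + 1, y) (?V - {(x, y + 1)}) - {(x + 1, y), (x + 1, y + 1)}
      = ?V - square_edge (x, y + 1) South"
    using notin by auto
  ultimately show ?B
    unfolding V using snake_vertices_corners[of x "y + 1" st]
    by (subst matching_sum_pendant[of _ "(x + 1, y)" "(x + 1, y + 1)"])
      (auto simp: finite_snake_vertices)
qed

section \<open>Snake graphs as induced subgraphs of the lattice\<close>

fun snake_edges :: "nat \<times> nat \<Rightarrow> side list \<Rightarrow> edge set" where
  "snake_edges p [] = range (square_edge p)"
| "snake_edges (x, y) (s # st) = range (square_edge (x, y)) \<union>
     snake_edges (if s = East then (x + 1, y) else (x, y + 1)) st"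

lemma range_square_edge:
  "range (square_edge (x, y)) =
     {square_edge (x, y) South, square_edge (x, y) West, square_edge (x, y) East, square_edge (x, y) North}"
proof -
  have "UNIV = {South, West, East, North}"
    using side.exhaust by auto
  then have "range (square_edge (x, y)) = square_edge (x, y) ` {South, West, East, North}" by presburger
  then show ?thesis by simp
qed

lemma lattice_edge_square_edge: "lattice_edge (square_edge p X)"
  by (cases p; cases X) (auto simp: lattice_edge_def)

lemma Union_snake_edges: "\<Union>(snake_edges (x, y) st) = snake_vertices (x, y) st"
  using snake_vertices_corners
  by (induction st arbitrary: x y) (auto simp: range_square_edge)

lemma lattice_edge_subset_square:
  assumes "lattice_edge e" "e \<subseteq> {(x, y), (x + 1, y), (x, y + 1), (x + 1, y + 1)}"
  shows "e \<in> range (square_edge (x, y))"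
proof -
  obtain a b where "e = {(a, b), (a + 1, b)} \<or> e = {(a, b), (a, b + 1)}"
    using assms(1) unfolding lattice_edge_def by blast
  then show ?thesis
  proof
    assume e: "e = {(a, b), (a + 1, b)}"
    then have "a = x \<and> (b = y \<or> b = y + 1)" using assms(2) by auto
    then have "e = square_edge (x, y) South \<or> e = square_edge (x, y) North" using e by auto
    then show ?thesis by blast
  next
    assume e: "e = {(a, b), (a, b + 1)}"
    then have "b = y \<and> (a = x \<or> a = x + 1)" using assms(2) by auto
    then have "e = square_edge (x, y) West \<or> e = square_edge (x, y) East" using e by auto
    then show ?thesis by blast
  qed
qed

lemma lattice_edge_subset_East:
  assumes "lattice_edge e" "e \<subseteq> {(x, y), (x, y + 1)} \<union> V" "\<And>a b. (a, b) \<in> V \<Longrightarrow> x + 1 \<le> a \<and> y \<le> b"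
  shows "e \<in> range (square_edge (x, y)) \<or> e \<subseteq> V"
proof -
  obtain a b where "e = {(a, b), (a + 1, b)} \<or> e = {(a, b), (a, b + 1)}"
    using assms(1) unfolding lattice_edge_def by blast
  then show ?thesis
  proof
    assume e: "e = {(a, b), (a + 1, b)}"
    then have "a = x \<and> (b = y \<or> b = y + 1) \<or> e \<subseteq> V"
      using assms(2) assms(3)[of a b] assms(3)[of "a + 1" b] by auto
    then have "e = square_edge (x, y) South \<or> e = square_edge (x, y) North \<or> e \<subseteq> V" using e by auto
    then show ?thesis by blast
  next
    assume e: "e = {(a, b), (a, b + 1)}"
    then have "a = x \<and> b = y \<or> e \<subseteq> V" using assms(2) assms(3)[of a b] assms(3)[of a "b + 1"] by auto
    then have "e = square_edge (x, y) West \<or> e \<subseteq> V" using e by auto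
    then show ?thesis by blast
  qed
qed

lemma lattice_edge_subset_North:
  assumes "lattice_edge e" "e \<subseteq> {(x, y), (x + 1, y)} \<union> V" "\<And>a b. (a, b) \<in> V \<Longrightarrow> x \<le> a \<and> y + 1 \<le> b"
  shows "e \<in> range (square_edge (x, y)) \<or> e \<subseteq> V"
proof -
  obtain a b where "e = {(a, b), (a + 1, b)} \<or> e = {(a, b), (a, b + 1)}"
    using assms(1) unfolding lattice_edge_def by blast
  then show ?thesis
  proof
    assume e: "e = {(a, b), (a + 1, b)}"
    then have "a = x \<and> b = y \<or> e \<subseteq> V" using assms(2) assms(3)[of a b] assms(3)[of "a + 1" b] by auto
    then have "e = square_edge (x, y) South \<or> e \<subseteq> V" using e by auto
    then show ?thesis by blast
  next
    assume e: "e = {(a, b), (a, b + 1)}"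
    then have "b = y \<and> (a = x \<or> a = x + 1) \<or> e \<subseteq> V"
      using assms(2) assms(3)[of a b] assms(3)[of a "b + 1"] by auto
    then have "e = square_edge (x, y) West \<or> e = square_edge (x, y) East \<or> e \<subseteq> V" using e by auto
    then show ?thesis by blast
  qed
qed

text \<open>A lattice edge outside the rest of the snake touches one of the two new corners of the
  first tile, whose neighbours in the region are all corners of that tile. Hence admitting arbitrary
  lattice edges creates no further matchings.\<close>

lemma snake_edges_induced: "snake_edges (x, y) st = {e. lattice_edge e \<and> e \<subseteq> snake_vertices (x, y) st}"
proof (induction st arbitrary: x y)
  case Nil
  have "e \<subseteq> snake_vertices (x, y) []" if "e \<in> range (square_edge (x, y))" for e
    using that unfolding range_square_edge by auto
  then show ?case
    using lattice_edge_square_edge lattice_edge_subset_square[of _ x y] by auto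
next
  case (Cons s st)
  show ?case
  proof (cases "s = East")
    case True
    let ?V = "snake_vertices (x + 1, y) st"
    have "e \<in> range (square_edge (x, y)) \<or> e \<subseteq> ?V"
      if "lattice_edge e" "e \<subseteq> {(x, y), (x, y + 1)} \<union> ?V" for e
      using lattice_edge_subset_East[OF that] snake_vertices_ge by blast
    moreover have "e \<subseteq> {(x, y), (x, y + 1)} \<union> ?V" if "e \<in> range (square_edge (x, y))" for e
      using that snake_vertices_corners[of "x + 1" y st] unfolding range_square_edge by auto
    ultimately show ?thesis
      using True Cons.IH[of "x + 1" y] lattice_edge_square_edge by auto
  next
    case False
    let ?V = "snake_vertices (x, y + 1) st"
    have "e \<in> range (square_edge (x, y)) \<or> e \<subseteq> ?V"
      if "lattice_edge e" "e \<subseteq> {(x, y), (x + 1, y)} \<union> ?V" for e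
      using lattice_edge_subset_North[OF that] snake_vertices_ge by blast
    moreover have "e \<subseteq> {(x, y), (x + 1, y)} \<union> ?V" if "e \<in> range (square_edge (x, y))" for e
      using that snake_vertices_corners[of x "y + 1" st] unfolding range_square_edge by auto
    ultimately show ?thesis
      using False Cons.IH[of x "y + 1"] lattice_edge_square_edge by auto
  qed
qed

lemma perfect_matchings_snake_edges:
  "perfect_matchings (snake_edges (x, y) st) = exact_matchings (snake_vertices (x, y) st)"
  unfolding perfect_matchings_def exact_matchings_def Union_snake_edges
  by (auto simp: snake_edges_induced)

section \<open>Subsnake graphs\<close>

definition tile_pos :: "side list \<Rightarrow> nat \<Rightarrow> nat \<times> nat" where
  "tile_pos st j = (count_list (take (j - 1) st) East, count_list (take (j - 1) st) North)"

lemma tile_edge_eq: "tile_edge st j = square_edge (tile_pos st j)"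
  by (simp add: tile_edge_def tile_pos_def)

lemma tile_pos_step:
  assumes "1 \<le> j" "j \<le> length st" "tile_pos st j = (x, y)"
  shows "st ! (j - 1) = East \<Longrightarrow> tile_pos st (Suc j) = (x + 1, y)"
    and "st ! (j - 1) = North \<Longrightarrow> tile_pos st (Suc j) = (x, y + 1)"
proof -
  have "take j st = take (j - 1) st @ [st ! (j - 1)]"
    using assms(1,2) take_Suc_conv_app_nth[of "j - 1" st] by simp
  then show "st ! (j - 1) = East \<Longrightarrow> tile_pos st (Suc j) = (x + 1, y)"
    and "st ! (j - 1) = North \<Longrightarrow> tile_pos st (Suc j) = (x, y + 1)"
    using assms(3) by (auto simp: tile_pos_def)
qed

lemma count_East_North:
  "set st \<subseteq> {North, East} \<Longrightarrow> count_list st East + count_list st North = length st"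
  by (induction st) auto

lemma tile_pos_sum:
  assumes "set st \<subseteq> {North, East}" "1 \<le> j" "j \<le> Suc (length st)"
  shows "fst (tile_pos st j) + snd (tile_pos st j) = j - 1"
  using count_East_North[of "take (j - 1) st"] assms set_take_subset[of "j - 1" st]
  by (simp add: tile_pos_def)

lemma step_North_or_East:
  assumes "set st \<subseteq> {North, East}" "1 \<le> j" "j \<le> length st"
  shows "st ! (j - 1) = North \<or> st ! (j - 1) = East"
proof -
  have "st ! (j - 1) \<in> set st" using assms(2,3) by (intro nth_mem) simp
  then show ?thesis using assms(1) by blast
qed

lemma steps_between:
  assumes "1 \<le> j" "j < k" "k \<le> Suc (length st)"
  shows "take (k - j) (drop (j - 1) st) = st ! (j - 1) # take (k - Suc j) (drop j st)"
proof -
  have "drop (j - 1) st = st ! (j - 1) # drop j st"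
    using assms Cons_nth_drop_Suc[of "j - 1" st] by simp
  moreover have "k - j = Suc (k - Suc j)" using assms by simp
  ultimately show ?thesis by simp
qed

lemma subsnake_eq_snake_edges:
  assumes st: "set st \<subseteq> {North, East}" and k: "k \<le> Suc (length st)"
    and i: "1 \<le> i" "i \<le> k"
  shows "subsnake st ne i k = snake_edges (tile_pos st i) (take (k - i) (drop (i - 1) st))"
  using i(2)
proof (induction rule: inc_induct)
  case base
  then show ?case by (auto simp: subsnake_def tile_edge_eq)
next
  case (step n)
  have n: "1 \<le> n" "n \<le> length st" using step.hyps i(1) k by auto
  obtain x y where p: "tile_pos st n = (x, y)" by fastforce
  have "subsnake st ne n k = range (tile_edge st n) \<union> subsnake st ne (Suc n) k"
  proof -
    have "subsnake st ne m k = (\<Union>j\<in>{m..k}. range (tile_edge st j))" if "m \<le> k" for m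
      using that by (auto simp: subsnake_def)
    moreover have "{n..k} = insert n {Suc n..k}" using step.hyps by auto
    ultimately show ?thesis using step.hyps by simp
  qed
  then have "subsnake st ne n k = range (square_edge (x, y)) \<union> subsnake st ne (Suc n) k"
    by (simp add: tile_edge_eq p)
  then show ?case
    using step.IH step_North_or_East[OF st n] tile_pos_step[OF n p] p
      steps_between[OF n(1) step.hyps(2) k] by auto
qed

abbreviation subsnake_vertices :: "side list \<Rightarrow> nat \<Rightarrow> nat \<Rightarrow> (nat \<times> nat) set" where
  "subsnake_vertices st i k \<equiv> snake_vertices (tile_pos st i) (take (k - i) (drop (i - 1) st))"

text \<open>\<open>A\<close> and \<open>B\<close> sum over the matchings that cover the southwest
  corner by the south or the west side, leaving out the weight of that side. With \<open>M\<close>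
  they form a closed system of recurrences that starts at the northeast end.\<close>

lemma matching_sum_subsnake:
  fixes w st k
  defines "M \<equiv> \<lambda>i. matching_sum w (subsnake_vertices st i k)"
  defines "A \<equiv> \<lambda>i. matching_sum w (subsnake_vertices st i k - tile_edge st i South)"
  defines "B \<equiv> \<lambda>i. matching_sum w (subsnake_vertices st i k - tile_edge st i West)"
  shows "M i = w (tile_edge st i South) * A i + w (tile_edge st i West) * B i"
    and "A k = w (tile_edge st k North)" and "B k = w (tile_edge st k East)"
    and "1 \<le> i \<Longrightarrow> i < k \<Longrightarrow> k \<le> Suc (length st) \<Longrightarrow> st ! (i - 1) = East \<Longrightarrow>
      A i = w (tile_edge st i North) * B (Suc i) \<and> B i = M (Suc i)"
    and "1 \<le> i \<Longrightarrow> i < k \<Longrightarrow> k \<le> Suc (length st) \<Longrightarrow> st ! (i - 1) = North \<Longrightarrow>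
      A i = M (Suc i) \<and> B i = w (tile_edge st i East) * A (Suc i)"
proof -
  obtain x y where p: "tile_pos st i = (x, y)" by fastforce
  show "M i = w (tile_edge st i South) * A i + w (tile_edge st i West) * B i"
    unfolding M_def A_def B_def tile_edge_eq p by (rule matching_sum_snake)
  show "A k = w (tile_edge st k North)" "B k = w (tile_edge st k East)"
    unfolding A_def B_def tile_edge_eq
    by (cases "tile_pos st k"; simp add: matching_sum_snake_Nil del: snake_vertices.simps square_edge.simps)+
  show "A i = w (tile_edge st i North) * B (Suc i) \<and> B i = M (Suc i)"
    if i: "1 \<le> i" "i < k" "k \<le> Suc (length st)" and E: "st ! (i - 1) = East"
    using tile_pos_step(1)[OF i(1) _ p E] i(2,3) matching_sum_snake_East[of w x y]
    unfolding M_def A_def B_def tile_edge_eq p steps_between[OF i] E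
    by (simp del: snake_vertices.simps square_edge.simps)
  show "A i = M (Suc i) \<and> B i = w (tile_edge st i East) * A (Suc i)"
    if i: "1 \<le> i" "i < k" "k \<le> Suc (length st)" and N: "st ! (i - 1) = North"
    using tile_pos_step(2)[OF i(1) _ p N] i(2,3) matching_sum_snake_North[of w x y]
    unfolding M_def A_def B_def tile_edge_eq p steps_between[OF i] N
    by (simp del: snake_vertices.simps square_edge.simps)
qed

lemma x_subsnake_eq:
  assumes "set (steps G) \<subseteq> {North, East}" "1 \<le> i" "i \<le> k" "k \<le> num_tiles G"
  shows "x_subsnake G ne i k =
    matching_sum (edge_weight G) (subsnake_vertices (steps G) i k) / (\<Prod>j\<in>{i..k}. tile_label G j)"
proof -
  obtain x y where "tile_pos (steps G) i = (x, y)" by fastforce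
  then show ?thesis
    using assms subsnake_eq_snake_edges[of "steps G" k i ne]
    by (simp add: x_subsnake_def perfect_matchings_snake_edges matching_sum_def num_tiles_def)
qed

text \<open>Comparing antidiagonals breaks the symmetry: a different square with the same edge can
  only be the northern or eastern neighbour.\<close>

lemma square_edge_eq_cases:
  assumes "square_edge p X = square_edge p' X'" "fst p + snd p \<le> fst p' + snd p'"
  shows "p = p' \<and> X = X' \<or>
    X = North \<and> X' = South \<and> p' = (fst p, snd p + 1) \<or>
    X = East \<and> X' = West \<and> p' = (fst p + 1, snd p)"
  using assms by (cases p; cases p'; cases X; cases X') (auto simp: doubleton_eq_iff)

section \<open>Ptolemy lengths along a crossing sequence\<close>

text \<open>
  Laurent polynomials of the curves that start at the two ends of the oriented side \<open>hd hs\<close>, or at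
  the vertex opposite to it, and end where \<open>Crossing hs\<close> ends.  They are defined by Ptolemy relations
  and not by matchings, which makes it evident that they do not depend on the choice of \<open>r\<close>.
\<close>

fun diag_lengths :: "('h, 'v::linorder) triangulation \<Rightarrow> 'h list \<Rightarrow> 'v ratfun \<times> 'v ratfun" where
  "diag_lengths T [] = (0, 0)"
| "diag_lengths T [h] =
     (label_weight (lab T (nxt T (opp T h))), label_weight (lab T (prv T (opp T h))))"
| "diag_lengths T (h # h' # hs) =
     (let (u, v) = diag_lengths T (h' # hs);
          a = (label_weight (lab T (nxt T h')) * u + label_weight (lab T (prv T h')) * v) /
              label_weight (lab T h')
      in if h' = nxt T (opp T h) then (u, a) else (a, v))"

definition apex_length :: "('h, 'v::linorder) triangulation \<Rightarrow> 'h list \<Rightarrow> 'v ratfun" where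
  "apex_length T hs =
     (label_weight (lab T (nxt T (hd hs))) * fst (diag_lengths T hs) +
      label_weight (lab T (prv T (hd hs))) * snd (diag_lengths T hs)) /
     label_weight (lab T (hd hs))"

text \<open>\<open>h\<close> and \<open>h'\<close> are two sides of the triangle between the
  crossings. Their common endpoint keeps its length, and the other end of \<open>h\<close> is the
  vertex opposite to \<open>h'\<close>.\<close>

lemma diag_lengths_Cons:
  "diag_lengths T (h # h' # hs) =
     (if h' = nxt T (opp T h) then (fst (diag_lengths T (h' # hs)), apex_length T (h' # hs))
      else (apex_length T (h' # hs), snd (diag_lengths T (h' # hs))))"
  by (simp add: apex_length_def Let_def split: prod.split)

declare diag_lengths.simps(3) [simp del]

lemma var_neq_0: "var v \<noteq> 0"
  by (simp add: var_def to_ratfun_def Zero_fract_def eq_fract)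

lemma label_weight_neq_0: "label_weight l \<noteq> 0"
  by (simp add: label_weight_def var_neq_0 split: option.split)

locale triangulated_surface =
  fixes T :: "('h::finite, 'v::{finite,linorder}) triangulation"
  assumes ideal: "ideal_triangulation T"
begin

lemma nxt_neq: "nxt T h \<noteq> h" and nxt3: "nxt T (nxt T (nxt T h)) = h"
  using ideal by (auto simp: ideal_triangulation_def)

lemma nxt_prv: "nxt T (prv T h) = h" and prv_nxt: "prv T (nxt T h) = h"
  and prv_prv: "prv T (prv T h) = nxt T h" and nxt_nxt: "nxt T (nxt T h) = prv T h"
  by (simp_all add: prv_def nxt3)

lemma prv_neq_nxt: "prv T h \<noteq> nxt T h" and prv_neq: "prv T h \<noteq> h"
  using nxt_neq nxt3 by (metis prv_def)+

lemma opp_lab: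
  assumes "lab T h \<noteq> None"
  shows "opp T h \<noteq> h \<and> lab T (opp T h) = lab T h"
proof -
  obtain v where v: "lab T h = Some v" using assms by blast
  have "card {g. lab T g = Some v} = 2"
    using ideal by (auto simp: ideal_triangulation_def)
  then obtain a b where "{g. lab T g = Some v} = {a, b}" "a \<noteq> b"
    by (auto simp: card_2_iff)
  then have "lab T g = lab T h \<longleftrightarrow> g = a \<or> g = b" for g using v by auto
  then have "\<exists>!g. g \<noteq> h \<and> lab T g = lab T h" using \<open>a \<noteq> b\<close> by metis
  then show ?thesis unfolding opp_def by (rule theI')
qed

abbreviation wt :: "'h \<Rightarrow> 'v ratfun" where
  "wt h \<equiv> label_weight (lab T h)"

lemma crossing_sequence_tl:
  "crossing_sequence T (h # h' # hs) \<Longrightarrow>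
     crossing_sequence T (h' # hs) \<and> h' \<in> {nxt T (opp T h), prv T (opp T h)}"
  by (force simp: crossing_sequence_def)

end

section \<open>Gluing and edge weights in the snake graph of a crossing sequence\<close>

locale crossing_arc = triangulated_surface T
  for T :: "('h::finite, 'v::{finite,linorder}) triangulation" +
  fixes r :: bool and hs :: "'h list"
  assumes crossing: "crossing_sequence T hs"
begin

abbreviation st :: "side list" where "st \<equiv> arc_steps T r hs"

abbreviation tile :: "nat \<Rightarrow> side \<Rightarrow> 'h" where
  "tile j \<equiv> tile_side T (r = odd j) (hs ! (j - 1))"

lemma length_hs: "1 \<le> length hs" and length_st: "Suc (length st) = length hs"
  using crossing by (auto simp: crossing_sequence_def arc_steps_def Suc_le_eq)

lemma lab_hs: "1 \<le> j \<Longrightarrow> j \<le> length hs \<Longrightarrow> lab T (hs ! (j - 1)) \<noteq> None"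
  using crossing by (auto simp: crossing_sequence_def)

lemma set_st: "set st \<subseteq> {North, East}"
  by (auto simp: arc_steps_def)

lemma st_nth: "1 \<le> j \<Longrightarrow> j < length hs \<Longrightarrow>
    st ! (j - 1) = (if tile j North = hs ! j then East else North)"
  by (simp add: arc_steps_def)

lemma next_crossing:
  assumes "1 \<le> j" "j < length hs"
  shows "hs ! j \<in> {nxt T (opp T (hs ! (j - 1))), prv T (opp T (hs ! (j - 1)))}"
proof -
  have "Suc (j - 1) < length hs" using assms by simp
  then have "hs ! Suc (j - 1) \<in> {nxt T (opp T (hs ! (j - 1))), prv T (opp T (hs ! (j - 1)))}"
    using crossing unfolding crossing_sequence_def by blast
  then show ?thesis using assms by simp
qed

text \<open>The northeast triangle of tile \<open>j\<close> is redrawn, mirrored, as the southwest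
  triangle of the next tile: its north side becomes the diagonal, its east side is the common edge,
  and the old diagonal becomes the south side.\<close>

lemma glue_East:
  assumes "1 \<le> j" "j < length hs" "st ! (j - 1) = East"
  shows "hs ! j = tile j North" "tile (Suc j) West = tile j East"
    "lab T (tile (Suc j) South) = lab T (hs ! (j - 1))"
proof -
  show h: "hs ! j = tile j North"
    using assms st_nth[of j] by (auto split: if_splits)
  then show "tile (Suc j) West = tile j East" by (auto simp: nxt_nxt prv_prv)
  show "lab T (tile (Suc j) South) = lab T (hs ! (j - 1))"
    using h opp_lab[OF lab_hs[of j]] assms(1,2) by (auto simp: nxt_prv prv_nxt)
qed

lemma glue_North:
  assumes "1 \<le> j" "j < length hs" "st ! (j - 1) = North"
  shows "hs ! j = tile j East" "tile (Suc j) South = tile j North"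
    "lab T (tile (Suc j) West) = lab T (hs ! (j - 1))"
proof -
  show h: "hs ! j = tile j East"
    using assms st_nth[of j] next_crossing[of j] by (auto split: if_splits)
  then show "tile (Suc j) South = tile j North" by (auto simp: nxt_nxt prv_prv)
  show "lab T (tile (Suc j) West) = lab T (hs ! (j - 1))"
    using h opp_lab[OF lab_hs[of j]] assms(1,2) by (auto simp: nxt_prv prv_nxt)
qed

text \<open>This makes the definite description in \<open>arc_edge_label\<close> meaningful. Tile
  \<open>j\<close> lies on antidiagonal \<open>j - 1\<close>, so tiles sharing an edge are equal or
  consecutive, and consecutive tiles are glued along one side of their common triangle.\<close>

lemma tile_eq_if_tile_edge_eq:
  assumes eq: "tile_edge st i X = tile_edge st j Y"
    and ij: "1 \<le> i" "i \<le> j" "j \<le> length hs"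
  shows "tile i X = tile j Y"
proof -
  have sum: "fst (tile_pos st m) + snd (tile_pos st m) = m - 1" if "1 \<le> m" "m \<le> length hs" for m
    using tile_pos_sum[OF set_st that(1)] that(2) length_st by simp
  have si: "fst (tile_pos st i) + snd (tile_pos st i) = i - 1"
    and sj: "fst (tile_pos st j) + snd (tile_pos st j) = j - 1"
    using sum ij by auto
  obtain x y where p: "tile_pos st i = (x, y)" by fastforce
  have "fst (tile_pos st i) + snd (tile_pos st i) \<le> fst (tile_pos st j) + snd (tile_pos st j)"
    unfolding si sj using ij(2) by simp
  then consider "tile_pos st i = tile_pos st j" "X = Y"
    | "X = North" "Y = South" "tile_pos st j = (x, y + 1)"
    | "X = East" "Y = West" "tile_pos st j = (x + 1, y)"
    using square_edge_eq_cases[of "tile_pos st i" X "tile_pos st j" Y] p eq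
    by (auto simp: tile_edge_eq)
  then show ?thesis
  proof cases
    case 1
    then have "i = j" using si sj ij(1,2) by simp
    then show ?thesis using 1 by simp
  next
    case 2
    then have j: "j = Suc i" using si sj ij(1,2) p by simp
    then have i: "i < length hs" "i \<le> length st" using ij(3) length_st by auto
    have "st ! (i - 1) = North"
      using step_North_or_East[OF set_st ij(1) i(2)] tile_pos_step(1)[OF ij(1) i(2) p] 2 j by auto
    then show ?thesis using glue_North(2)[OF ij(1) i(1)] 2 j by simp
  next
    case 3
    then have j: "j = Suc i" using si sj ij(1,2) p by simp
    then have i: "i < length hs" "i \<le> length st" using ij(3) length_st by auto
    have "st ! (i - 1) = East"
      using step_North_or_East[OF set_st ij(1) i(2)] tile_pos_step(2)[OF ij(1) i(2) p] 3 j by auto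
    then show ?thesis using glue_East(2)[OF ij(1) i(1)] 3 j by simp
  qed
qed

lemma edge_weight_tile:
  assumes "1 \<le> j" "j \<le> length hs"
  shows "edge_weight (arc_snake T r hs) (tile_edge st j X) = wt (tile j X)"
proof -
  have "arc_edge_label T r hs (tile_edge st j X) = lab T (tile j X)"
    unfolding arc_edge_label_def
  proof (rule the_equality)
    show "\<exists>i\<in>{1..length hs}. \<exists>Y. tile_edge st j X = tile_edge st i Y \<and> lab T (tile j X) = lab T (tile i Y)"
      using assms by auto
  next
    fix l
    assume "\<exists>i\<in>{1..length hs}. \<exists>Y. tile_edge st j X = tile_edge st i Y \<and> l = lab T (tile i Y)"
    then obtain i Y where i: "1 \<le> i" "i \<le> length hs" "tile_edge st j X = tile_edge st i Y"
      "l = lab T (tile i Y)" by auto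
    then have "tile i Y = tile j X"
      using tile_eq_if_tile_edge_eq[of i Y j X] tile_eq_if_tile_edge_eq[of j X i Y] assms
      by (cases "i \<le> j") auto
    then show "l = lab T (tile j X)" using i(4) by simp
  qed
  then show ?thesis by (simp add: arc_snake_def)
qed

section \<open>Matching sums expressed by Ptolemy lengths\<close>

definition sub :: "nat \<Rightarrow> nat \<Rightarrow> 'h list" where
  "sub j k = drop (j - 1) (take k hs)"

lemma sub_Cons: "1 \<le> j \<Longrightarrow> j \<le> k \<Longrightarrow> k \<le> length hs \<Longrightarrow> sub j k = hs ! (j - 1) # sub (Suc j) k"
  using Cons_nth_drop_Suc[of "j - 1" "take k hs"] by (simp add: sub_def)

lemma sub_empty: "sub (Suc k) k = []"
  by (simp add: sub_def)

text \<open>Lambda lengths from the northwest and southeast corners of tile \<open>j\<close> and from the southwest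
  one to the northeast corner of tile \<open>k\<close>.\<close>

definition len_NW :: "nat \<Rightarrow> nat \<Rightarrow> 'v ratfun" where
  "len_NW j k = (if r = odd j then snd else fst) (diag_lengths T (sub j k))"

definition len_SE :: "nat \<Rightarrow> nat \<Rightarrow> 'v ratfun" where
  "len_SE j k = (if r = odd j then fst else snd) (diag_lengths T (sub j k))"

definition len_SW :: "nat \<Rightarrow> nat \<Rightarrow> 'v ratfun" where
  "len_SW j k = apex_length T (sub j k)"

lemma len_ptolemy:
  assumes "1 \<le> j" "j \<le> k" "k \<le> length hs"
  shows "wt (hs ! (j - 1)) * len_SW j k = wt (tile j South) * len_NW j k + wt (tile j West) * len_SE j k"
  using sub_Cons[OF assms] label_weight_neq_0
  by (auto simp: len_SW_def len_NW_def len_SE_def apex_length_def)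

lemma len_last:
  assumes "1 \<le> k" "k \<le> length hs"
  shows "len_NW k k = wt (tile k North)" "len_SE k k = wt (tile k East)"
  using sub_Cons[OF assms(1) order_refl assms(2)]
  by (auto simp: len_NW_def len_SE_def sub_empty)

lemma diag_lengths_sub:
  assumes "1 \<le> j" "j < k" "k \<le> length hs"
  shows "diag_lengths T (sub j k) =
    (if hs ! j = nxt T (opp T (hs ! (j - 1)))
     then (fst (diag_lengths T (sub (Suc j) k)), len_SW (Suc j) k)
     else (len_SW (Suc j) k, snd (diag_lengths T (sub (Suc j) k))))"
  using sub_Cons[of j k] sub_Cons[of "Suc j" k] assms
  by (simp add: len_SW_def diag_lengths_Cons)

text \<open>The southeast corner of the next tile is the same vertex of the surface as the northwest
  corner of tile \<open>j\<close>, and the southwest corner of the next tile is the southeast corner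
  of tile \<open>j\<close>.\<close>

lemma len_East:
  assumes "1 \<le> j" "j < k" "k \<le> length hs" "st ! (j - 1) = East"
  shows "len_NW j k = len_SE (Suc j) k" "len_SE j k = len_SW (Suc j) k"
  using glue_East(1)[of j] assms prv_neq_nxt
  by (auto simp: len_NW_def len_SE_def diag_lengths_sub)

lemma len_North:
  assumes "1 \<le> j" "j < k" "k \<le> length hs" "st ! (j - 1) = North"
  shows "len_NW j k = len_SW (Suc j) k" "len_SE j k = len_NW (Suc j) k"
  using glue_North(1)[of j] assms prv_neq_nxt
  by (auto simp: len_NW_def len_SE_def diag_lengths_sub)

text \<open>Both sides obey the same recurrences, from tile \<open>k\<close> backwards. Only the
  length from the southwest corner involves division by the diagonal of tile \<open>i\<close>, so
  only its product includes that label.\<close>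

lemma matching_sum_len:
  fixes k
  defines "w \<equiv> edge_weight (arc_snake T r hs)"
  assumes k: "k \<le> length hs" and i: "1 \<le> i" "i \<le> k"
  shows "matching_sum w (subsnake_vertices st i k - tile_edge st i South) =
       len_NW i k * (\<Prod>j\<in>{Suc i..k}. wt (hs ! (j - 1))) \<and>
     matching_sum w (subsnake_vertices st i k - tile_edge st i West) =
       len_SE i k * (\<Prod>j\<in>{Suc i..k}. wt (hs ! (j - 1))) \<and>
     matching_sum w (subsnake_vertices st i k) =
       len_SW i k * (\<Prod>j\<in>{i..k}. wt (hs ! (j - 1)))"
  using i(2)
proof (induction rule: inc_induct)
  case base
  show ?case
    using i k len_ptolemy[of k k] len_last[of k] matching_sum_subsnake(1)[of w st k k]
      matching_sum_subsnake(2,3)[of w st k]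
    by (simp add: edge_weight_tile w_def algebra_simps)
next
  case (step n)
  have n: "1 \<le> n" "n < k" "n < length hs" "n \<le> length hs" "n \<le> length st" "n \<le> k"
    using step.hyps i(1) k length_st by auto
  have k': "k \<le> Suc (length st)" using k length_st by simp
  have prod: "(\<Prod>j\<in>{m..k}. wt (hs ! (j - 1))) = wt (hs ! (m - 1)) * (\<Prod>j\<in>{Suc m..k}. wt (hs ! (j - 1)))"
    if "m \<le> k" for m using that by (simp add: prod.atLeast_Suc_atMost)
  have AB: "matching_sum w (subsnake_vertices st n k - tile_edge st n South) =
       len_NW n k * (\<Prod>j\<in>{Suc n..k}. wt (hs ! (j - 1))) \<and>
     matching_sum w (subsnake_vertices st n k - tile_edge st n West) =
       len_SE n k * (\<Prod>j\<in>{Suc n..k}. wt (hs ! (j - 1)))"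
  proof (cases "st ! (n - 1) = East")
    case True
    \<comment> \<open>The forced north side carries the label of tile \<open>Suc n\<close>, which is
      the factor missing from the product in the induction hypothesis.\<close>
    have "w (tile_edge st n North) = wt (hs ! n)"
      using glue_East(1)[OF n(1,3) True] edge_weight_tile[OF n(1,4), of North]
      unfolding w_def by metis
    then show ?thesis
      using matching_sum_subsnake(4)[OF n(1,2) k' True, of w] len_East[OF n(1,2) k True]
        step.IH prod[of "Suc n"] n by (simp add: algebra_simps)
  next
    case False
    then have N: "st ! (n - 1) = North" using step_North_or_East[OF set_st n(1,5)] by simp
    have "w (tile_edge st n East) = wt (hs ! n)"
      using glue_North(1)[OF n(1,3) N] edge_weight_tile[OF n(1,4), of East]
      unfolding w_def by metis
    then show ?thesis
      using matching_sum_subsnake(5)[OF n(1,2) k' N, of w] len_North[OF n(1,2) k N]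
        step.IH prod[of "Suc n"] n by (simp add: algebra_simps)
  qed
  let ?R = "\<Prod>j\<in>{Suc n..k}. wt (hs ! (j - 1))"
  have "matching_sum w (subsnake_vertices st n k) =
      (wt (tile n South) * len_NW n k + wt (tile n West) * len_SE n k) * ?R"
    unfolding matching_sum_subsnake(1)[of w st n k] AB[THEN conjunct1] AB[THEN conjunct2]
      edge_weight_tile[OF n(1,4), folded w_def]
    by (simp add: algebra_simps del: tile_side.simps)
  also have "\<dots> = wt (hs ! (n - 1)) * len_SW n k * ?R"
    using len_ptolemy[OF n(1,6) k] by simp
  finally have "matching_sum w (subsnake_vertices st n k) =
      len_SW n k * (\<Prod>j\<in>{n..k}. wt (hs ! (j - 1)))"
    using prod[OF n(6)] by (simp add: mult_ac)
  then show ?case using AB by simp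
qed

lemma x_subsnake_arc:
  assumes "1 \<le> i" "i \<le> k" "k \<le> length hs"
  shows "x_subsnake (arc_snake T r hs) ne i k = apex_length T (drop (i - 1) (take k hs))"
proof -
  have "(\<Prod>j\<in>{i..k}. wt (hs ! (j - 1))) \<noteq> 0" by (simp add: label_weight_neq_0)
  moreover have "steps (arc_snake T r hs) = st" "tile_label (arc_snake T r hs) = (\<lambda>j. wt (hs ! (j - 1)))"
    by (simp_all add: arc_snake_def)
  ultimately show ?thesis
    using x_subsnake_eq[of "arc_snake T r hs" i k ne] assms matching_sum_len[of k i] set_st length_st
    by (simp add: num_tiles_def len_SW_def sub_def)
qed

end

section \<open>Curves from the corners of the first triangle\<close>

context triangulated_surface
begin

lemma x_curve_Crossing:
  assumes "crossing_sequence T hs"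
  shows "x_curve T (Crossing hs) = apex_length T hs"
proof -
  \<comment> \<open>\<open>x_curve\<close> fixes the orientation \<open>True\<close>. The value
    \<open>apex_length\<close> mentions no orientation and so can be compared with the snake graph
    drawn with any \<open>r\<close>.\<close>
  interpret crossing_arc T True hs
    using assms by unfold_locales
  have "num_tiles (arc_snake T True hs) = length hs"
    using length_st by (simp add: num_tiles_def arc_snake_def)
  then show ?thesis
    using x_subsnake_arc[of 1 "length hs" North] length_hs by (simp add: x_snake_def)
qed

text \<open>Pulling the curve over an end of the first crossed side moves its start to a corner of
  the next triangle, just as \<open>diag_lengths\<close> recurses. All three corners are treated
  together, since that corner may be opposite to the next crossing, where the pulling stops.\<close>

lemma x_curve_from_corner:
  assumes "crossing_sequence T hs" "t = prv T (opp T (last hs))"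
  shows "x_curve T (from_corner T t (hd hs) hs) = fst (diag_lengths T hs) \<and>
    x_curve T (from_corner T t (nxt T (hd hs)) hs) = snd (diag_lengths T hs) \<and>
    x_curve T (from_corner T t (prv T (hd hs)) hs) = apex_length T hs"
  using assms
proof (induction hs rule: induct_list012)
  case 1
  then show ?case by (simp add: crossing_sequence_def)
next
  case (2 h)
  have "from_corner T t (prv T h) [h] = Crossing [h]"
    using prv_neq[of h] nxt_neq[of h] by (auto simp: prv_prv)
  moreover have "from_corner T t (nxt T h) [h] = Side (prv T (opp T h))"
    using 2(2) nxt_neq[of h] prv_neq_nxt[of "opp T h"] by (auto simp: prv_nxt)
  ultimately show ?case
    using 2 x_curve_Crossing by (simp add: nxt_nxt)
next
  case (3 h h' hs)
  have cs: "crossing_sequence T (h' # hs)" and h': "h' = nxt T (opp T h) \<or> h' = prv T (opp T h)"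
    using crossing_sequence_tl[OF 3(3)] by auto
  have IH: "x_curve T (from_corner T t h' (h' # hs)) = fst (diag_lengths T (h' # hs))"
    "x_curve T (from_corner T t (nxt T h') (h' # hs)) = snd (diag_lengths T (h' # hs))"
    "x_curve T (from_corner T t (prv T h') (h' # hs)) = apex_length T (h' # hs)"
    using 3(2)[OF cs] 3(4) by auto
  have "from_corner T t (prv T h) (h # h' # hs) = Crossing (h # h' # hs)"
    using prv_neq[of h] nxt_neq[of h] by (auto simp: prv_prv)
  moreover have "from_corner T t (nxt T h) (h # h' # hs) = from_corner T t (opp T h) (h' # hs)"
    using nxt_neq[of h] by (auto simp: prv_nxt simp del: from_corner.simps(2)
      simp add: from_corner.simps(2)[of T t "nxt T h" h])
  moreover have "from_corner T t h (h # h' # hs) = from_corner T t (nxt T (opp T h)) (h' # hs)"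
    by simp
  ultimately show ?case
    using h' IH x_curve_Crossing[OF 3(3)] prv_neq_nxt[of "opp T h"]
    by (auto simp: diag_lengths_Cons prv_nxt nxt_prv prv_prv nxt_nxt simp del: from_corner.simps)
qed

text \<open>The composition starts at the far end of the west side, the northwest corner of the
  first tile. It is the end of the first crossed side if \<open>r\<close> holds and its start
  otherwise.\<close>

lemma x_curve_gamma':
  assumes "crossing_sequence T hs"
  shows "x_curve T (gamma' T r hs) = (if r then snd else fst) (diag_lengths T hs)"
  using x_curve_from_corner[OF assms refl] prv_neq_nxt[of "hd hs"]
  by (auto simp: gamma'_def compose_side_def)

end

section \<open>Positivity and coprimality\<close>

lemma to_ratfun_add: "to_ratfun p + to_ratfun q = to_ratfun (p + q)"
  and to_ratfun_diff: "to_ratfun p - to_ratfun q = to_ratfun (p - q)"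
  and to_ratfun_mult: "to_ratfun p * to_ratfun q = to_ratfun (p * q)"
  and to_ratfun_1: "to_ratfun 1 = 1"
  and to_ratfun_eq_iff: "to_ratfun p = to_ratfun q \<longleftrightarrow> p = q"
  by (simp_all add: to_ratfun_def One_fract_def eq_fract)

lemma inverse_var:
  "inverse (var v) = to_ratfun (Poly_Mapping.single (Poly_Mapping.single v (- 1)) 1)"
proof -
  have "var v * to_ratfun (Poly_Mapping.single (Poly_Mapping.single v (- 1)) 1) = 1"
    by (simp add: var_def to_ratfun_mult mult_single single_add[symmetric] to_ratfun_1)
  then show ?thesis by (simp add: inverse_unique)
qed

text \<open>Sums in this set cannot cancel, so membership proves at once that an element of the
  fraction field is a Laurent polynomial and that it is not zero.\<close>

definition positive_laurent :: "'v::linorder ratfun set" where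
  "positive_laurent = to_ratfun ` {p. p \<noteq> 0 \<and> (\<forall>m. 0 \<le> Poly_Mapping.lookup p m)}"

lemma positive_laurent_neq_0: "z \<in> positive_laurent \<Longrightarrow> z \<noteq> 0"
  by (auto simp: positive_laurent_def to_ratfun_def Zero_fract_def eq_fract)

lemma positive_laurent_add:
  assumes "y \<in> positive_laurent" "z \<in> positive_laurent"
  shows "y + z \<in> positive_laurent"
proof -
  obtain p q where pq: "y = to_ratfun p" "z = to_ratfun q" "p \<noteq> 0" "q \<noteq> 0"
    "\<forall>m. 0 \<le> Poly_Mapping.lookup p m" "\<forall>m. 0 \<le> Poly_Mapping.lookup q m"
    using assms by (auto simp: positive_laurent_def)
  have "p + q \<noteq> 0"
  proof
    assume "p + q = 0"
    then have "Poly_Mapping.lookup p m + Poly_Mapping.lookup q m = 0" for m by (metis lookup_add lookup_zero)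
    then have "Poly_Mapping.lookup p m = 0" for m using pq(5,6) by (metis add_nonneg_eq_0_iff)
    then have "p = 0" by (intro poly_mapping_eqI) simp
    then show False using pq(3) by simp
  qed
  then show ?thesis using pq
    by (auto simp: positive_laurent_def to_ratfun_add lookup_add intro!: imageI)
qed

lemma Sum_any_nonneg: "(\<And>a. 0 \<le> g a) \<Longrightarrow> 0 \<le> Sum_any g" for g :: "'b \<Rightarrow> int"
  by (simp add: Sum_any.expand_set sum_nonneg)

lemma positive_laurent_mult:
  assumes "y \<in> positive_laurent" "z \<in> positive_laurent"
  shows "y * z \<in> positive_laurent"
proof -
  obtain p q where pq: "y = to_ratfun p" "z = to_ratfun q" "p \<noteq> 0" "q \<noteq> 0"
    "\<forall>m. 0 \<le> Poly_Mapping.lookup p m" "\<forall>m. 0 \<le> Poly_Mapping.lookup q m"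
    using assms by (auto simp: positive_laurent_def)
  have "0 \<le> Poly_Mapping.lookup (p * q) m" for m
    unfolding lookup_mult using pq(5,6)
    by (intro Sum_any_nonneg mult_nonneg_nonneg) (auto simp: when_def)
  then show ?thesis using pq
    by (auto simp: positive_laurent_def to_ratfun_mult intro!: imageI)
qed

text \<open>Labels are variables or \<open>1\<close>, hence units of the Laurent ring. Dividing by
  them in a Ptolemy relation therefore preserves positivity.\<close>

lemma positive_laurent_label_weight:
  fixes l :: "'v::linorder option"
  shows "label_weight l \<in> positive_laurent" "inverse (label_weight l) \<in> positive_laurent"
proof -
  have mono: "to_ratfun (Poly_Mapping.single m 1) \<in> positive_laurent" for m :: "'v \<Rightarrow>\<^sub>0 int"
    unfolding positive_laurent_def by (rule imageI) (simp add: lookup_single when_def)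
  from mono[of 0] have "1 \<in> (positive_laurent :: 'v ratfun set)" by (simp add: to_ratfun_1)
  then show "label_weight l \<in> positive_laurent" "inverse (label_weight l) \<in> positive_laurent"
    using mono by (auto simp: label_weight_def inverse_var var_def[symmetric] split: option.split)
      (simp_all add: var_def mono)
qed

lemma apex_length_alt:
  "apex_length T hs = inverse (label_weight (lab T (hd hs))) *
     (label_weight (lab T (nxt T (hd hs))) * fst (diag_lengths T hs) +
      label_weight (lab T (prv T (hd hs))) * snd (diag_lengths T hs))"
  by (simp add: apex_length_def divide_inverse mult.commute)

lemma positive_laurent_lengths:
  assumes "hs \<noteq> []"
  shows "fst (diag_lengths T hs) \<in> positive_laurent \<and> snd (diag_lengths T hs) \<in> positive_laurent
    \<and> apex_length T hs \<in> positive_laurent"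
  using assms
proof (induction hs rule: induct_list012)
  case (2 h)
  then show ?case unfolding apex_length_alt
    by (auto intro!: positive_laurent_add positive_laurent_mult positive_laurent_label_weight)
next
  case (3 h h' hs)
  then have "fst (diag_lengths T (h # h' # hs)) \<in> positive_laurent
      \<and> snd (diag_lengths T (h # h' # hs)) \<in> positive_laurent"
    by (auto simp: diag_lengths_Cons)
  then show ?case unfolding apex_length_alt
    by (auto intro!: positive_laurent_add positive_laurent_mult positive_laurent_label_weight)
qed simp

text \<open>The principal ideal of \<open>c\<close>, placed in the fraction field because the
  lengths live there and divisibility inside a field carries no information.\<close>

definition multiples :: "'v::linorder laurent \<Rightarrow> 'v ratfun set" where
  "multiples c = {to_ratfun (c * k) | k. True}"

lemma multiples_diff: "y \<in> multiples c \<Longrightarrow> z \<in> multiples c \<Longrightarrow> y - z \<in> multiples c"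
  by (auto simp: multiples_def to_ratfun_diff to_ratfun_eq_iff right_diff_distrib[symmetric])

lemma multiples_mult:
  assumes "y \<in> positive_laurent" "z \<in> multiples c"
  shows "y * z \<in> multiples c"
proof -
  obtain p k where "y = to_ratfun p" "z = to_ratfun (c * k)"
    using assms by (auto simp: multiples_def positive_laurent_def)
  then have "y * z = to_ratfun (c * (p * k))" by (simp add: to_ratfun_mult mult_ac)
  then show ?thesis by (auto simp: multiples_def)
qed

lemma multiples_label_weightD:
  assumes "label_weight l * z \<in> multiples c"
  shows "z \<in> multiples c"
  using multiples_mult[OF positive_laurent_label_weight(2)[of l] assms] label_weight_neq_0[of l]
  by (simp add: mult.assoc[symmetric])

text \<open>The Ptolemy relation can be solved for either of the two lengths, because its
  coefficients are units.\<close>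

lemma multiples_apex_length:
  assumes "apex_length T hs \<in> multiples c"
  shows "fst (diag_lengths T hs) \<in> multiples c \<longleftrightarrow> snd (diag_lengths T hs) \<in> multiples c"
proof -
  let ?w = "\<lambda>h. label_weight (lab T h)" and ?h = "hd hs"
  have eq: "?w ?h * apex_length T hs - ?w (nxt T ?h) * fst (diag_lengths T hs)
      = ?w (prv T ?h) * snd (diag_lengths T hs)"
    "?w ?h * apex_length T hs - ?w (prv T ?h) * snd (diag_lengths T hs)
      = ?w (nxt T ?h) * fst (diag_lengths T hs)"
    by (simp_all add: apex_length_def label_weight_neq_0)
  have *: "?w g * z \<in> multiples c" if "z \<in> multiples c" for g z
    using that by (rule multiples_mult[OF positive_laurent_label_weight(1)])
  show ?thesis
    using multiples_diff[OF *[OF assms, of ?h] *[of "fst (diag_lengths T hs)" "nxt T ?h"]]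
      multiples_diff[OF *[OF assms, of ?h] *[of "snd (diag_lengths T hs)" "prv T ?h"]]
    unfolding eq using multiples_label_weightD by blast
qed

text \<open>The Euclidean algorithm, one tile at a time; it ends because the last side is a unit.\<close>

lemma one_multiple_if_diag_lengths:
  assumes "hs \<noteq> []" "fst (diag_lengths T hs) \<in> multiples c" "snd (diag_lengths T hs) \<in> multiples c"
  shows "1 \<in> multiples c"
  using assms
proof (induction hs rule: induct_list012)
  case (2 h)
  then show ?case using multiples_label_weightD[of _ 1] by simp
next
  case (3 h h' hs)
  then show ?case
    using multiples_apex_length[of T "h' # hs" c] by (auto simp: diag_lengths_Cons split: if_splits)
qed simp

text \<open>A common divisor also divides the remaining length in the first Ptolemy relation, and
  the Euclidean descent then shows that it divides \<open>1\<close>.\<close>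

lemma rel_prime_lengths:
  assumes "hs \<noteq> []" and x: "apex_length T hs = to_ratfun p"
    and y: "to_ratfun q \<in> {fst (diag_lengths T hs), snd (diag_lengths T hs)}"
  shows "rel_prime p q"
  unfolding rel_prime_def
proof (intro allI impI)
  fix c assume "c dvd p" "c dvd q"
  then have "to_ratfun p \<in> multiples c" "to_ratfun q \<in> multiples c"
    by (auto simp: multiples_def dvd_def)
  then have "1 \<in> multiples c"
    using one_multiple_if_diag_lengths[OF assms(1)] multiples_apex_length[of T hs c] x y by auto
  then show "c dvd 1"
    by (auto simp: multiples_def to_ratfun_1[symmetric] to_ratfun_eq_iff dvd_def)
qed

section \<open>Fans and continued fractions\<close>

text \<open>\<open>x\<close> are the diagonals of a fan, \<open>e\<close> its outer sides, and
  \<open>X\<close>, \<open>C\<close>, \<open>D\<close> the lengths from apex, center and rim.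
  Divided by \<open>x (j - 1) * x j\<close>, the relation expresses \<open>X j / x (j - 1)\<close>
  by \<open>X (Suc j) / x j\<close> and a multiple of the constant \<open>C\<close>, so the sum
  telescopes.\<close>

lemma fan_identity:
  fixes x e X C D :: "nat \<Rightarrow> 'a::field"
  assumes "p \<le> q"
    and ptolemy: "\<And>j. p \<le> j \<Longrightarrow> j \<le> q \<Longrightarrow> x j * X j = e (j - 1) * C j + x (j - 1) * D j"
    and fan: "\<And>j. p \<le> j \<Longrightarrow> j < q \<Longrightarrow> C (Suc j) = C j \<and> D j = X (Suc j)"
    and nz: "\<And>j. x j \<noteq> 0"
  shows "x q * X p = x (p - 1) * x q * (\<Sum>j=p..q. e (j - 1) / (x (j - 1) * x j)) * C p + x (p - 1) * D q
    \<and> C q = C p"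
  using assms(1)
proof (induction rule: inc_induct)
  case base
  then show ?case using ptolemy[of q] assms(1) nz by simp
next
  case (step n)
  let ?S = "\<lambda>m. \<Sum>j=m..q. e (j - 1) / (x (j - 1) * x j)"
  have S: "?S n = e (n - 1) / (x (n - 1) * x n) + ?S (Suc n)"
    using step.hyps by (simp add: sum.atLeast_Suc_atMost)
  have "x n * X n = e (n - 1) * C n + x (n - 1) * X (Suc n)"
    using ptolemy[of n] fan[of n] step.hyps by simp
  then have "x q * (x n * X n) = x q * (e (n - 1) * C n + x (n - 1) * X (Suc n))" by simp
  then have "x n * (x q * X n) = x q * e (n - 1) * C n + x (n - 1) * (x q * X (Suc n))"
    by (simp add: mult_ac distrib_left)
  also have "x q * X (Suc n) = x n * x q * ?S (Suc n) * C n + x n * D q"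
    using step.IH fan[of n] step.hyps by simp
  finally have "x n * (x q * X n)
      = x n * (x (n - 1) * x q * ?S n * C n + x (n - 1) * D q)"
    unfolding S using nz[of n] nz[of "n - 1"] by (simp add: field_simps)
  then have "x q * X n = x (n - 1) * x q * ?S n * C n + x (n - 1) * D q" using nz[of n] by simp
  then show ?case using step.IH fan[of n] step.hyps by simp
qed

text \<open>Dividing the recurrence by \<open>b i * F i\<close> gives a continued fraction for
  \<open>F (i - 1) / F i\<close> with partial numerators \<open>b (i - 1) / b i\<close>. The
  condition on \<open>\<kappa>\<close> is what turns these numerators into \<open>1\<close>, and
  \<open>F (Suc n) = 0\<close> ends the expansion.\<close>

lemma cfrac_eq_ratio:
  fixes b F H \<kappa> L :: "nat \<Rightarrow> 'a::field"
  assumes rec: "\<And>i. 1 \<le> i \<Longrightarrow> i \<le> n \<Longrightarrow> b i * F (i - 1) = H i * F i + b (i - 1) * F (Suc i)"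
    and F: "\<And>i. i \<le> n \<Longrightarrow> F i \<noteq> 0" "F (Suc n) = 0"
    and b: "\<And>i. b i \<noteq> 0"
    and \<kappa>: "\<And>i. \<kappa> i \<noteq> 0" "\<And>i. 1 \<le> i \<Longrightarrow> \<kappa> i * \<kappa> (Suc i) = b i / b (i - 1)"
    and L: "\<And>i. L i = \<kappa> i * H i / b i"
    and i: "1 \<le> i" "i \<le> n"
  shows "cfrac (map L [i..<n + 1]) = \<kappa> i * F (i - 1) / F i"
  using i(2)
proof (induction rule: inc_induct)
  case base
  show ?case using rec[of n] i F b[of n] by (simp add: L field_simps)
next
  case (step m)
  have m: "1 \<le> m" "m < n" using step.hyps i by auto
  have "map L [m..<n + 1] = L m # map L [Suc m..<n + 1]" "map L [Suc m..<n + 1] \<noteq> []"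
    using m by (simp_all add: upt_conv_Cons)
  then have "cfrac (map L [m..<n + 1]) = L m + 1 / cfrac (map L [Suc m..<n + 1])"
    by (metis cfrac.simps(3) list.exhaust)
  also have "\<dots> = \<kappa> m * H m / b m + F (Suc m) / (\<kappa> (Suc m) * F m)"
    unfolding step.IH by (simp add: L)
  also have "\<dots> = \<kappa> m * (H m * F m + b (m - 1) * F (Suc m)) / (b m * F m)"
  proof -
    have "\<kappa> m = b m / b (m - 1) / \<kappa> (Suc m)"
      using \<kappa>(2)[OF m(1)] \<kappa>(1)[of "Suc m"] by (metis nonzero_mult_div_cancel_right)
    then have "F (Suc m) / (\<kappa> (Suc m) * F m) = \<kappa> m * b (m - 1) * F (Suc m) / (b m * F m)"
      using b[of m] b[of "m - 1"] by simp
    then show ?thesis using F(1)[of m] m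
      by (simp add: add_divide_distrib distrib_left mult.assoc[symmetric])
  qed
  also have "\<dots> = \<kappa> m * F (m - 1) / F m"
    unfolding rec[OF m(1) less_imp_le[OF m(2)], symmetric] using b[of m] by simp
  finally show ?case .
qed

text \<open>The monomial separating \<open>L_poly\<close> from \<open>x_H\<close> divided by
  \<open>b_weight\<close>; it serves as the scaling \<open>\<kappa>\<close>.\<close>

definition L_factor :: "(nat \<Rightarrow> 'a::field) \<Rightarrow> nat \<Rightarrow> 'a" where
  "L_factor b i =
     (if i = 1 then 1
      else if odd i then
        b 0 * (\<Prod>k\<in>{k\<in>{2..i - 3}. even k}. (b k)\<^sup>2) * b (i - 1) /
          (\<Prod>k\<in>{k\<in>{1..i - 2}. odd k}. (b k)\<^sup>2)
      else
        (\<Prod>k\<in>{k\<in>{1..i - 3}. odd k}. (b k)\<^sup>2) * b (i - 1) /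
          (b 0 * (\<Prod>k\<in>{k\<in>{2..i - 2}. even k}. (b k)\<^sup>2)))"

lemma L_poly_eq:
  "L_poly G ne as i = L_factor (b_weight G ne as) i * x_H G ne as i / b_weight G ne as i"
  by (simp add: L_poly_def L_factor_def Let_def)

lemma L_factor_neq_0: "(\<And>i. b i \<noteq> 0) \<Longrightarrow> L_factor b i \<noteq> 0"
  by (simp add: L_factor_def)

text \<open>The squares in consecutive factors cancel, except that the second denominator contains
  one new square, of \<open>b (i - 1)\<close>. One of its two powers cancels against the numerator
  of the first factor.\<close>

lemma L_factor_mult:
  assumes b: "\<And>i. b i \<noteq> 0" and i: "1 \<le> i"
  shows "L_factor b i * L_factor b (Suc i) = b i / b (i - 1)"
proof (cases "i = 1")
  case True
  then show ?thesis by (simp add: L_factor_def)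
next
  case False
  define Ev where "Ev m = (\<Prod>k\<in>{k\<in>{2..m}. even k}. (b k)\<^sup>2)" for m
  define Od where "Od m = (\<Prod>k\<in>{k\<in>{1..m}. odd k}. (b k)\<^sup>2)" for m
  have nz: "Ev m \<noteq> 0" "Od m \<noteq> 0" for m using b by (simp_all add: Ev_def Od_def)
  show ?thesis
  proof (cases "odd i")
    case True
    then have i3: "3 \<le> i" using False i by presburger
    have "k = i - 1 \<or> k \<le> i - 3" if "k \<le> i - 1" "even k" for k
      using that True i3 by presburger
    then have "{k\<in>{2..i - 1}. even k} = insert (i - 1) {k\<in>{2..i - 3}. even k}"
      using True i3 by fastforce
    moreover have "i - 1 \<notin> {k\<in>{2..i - 3}. even k}" using i3 by auto
    ultimately have Ev: "Ev (i - 1) = (b (i - 1))\<^sup>2 * Ev (i - 3)" by (simp add: Ev_def)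
    have "L_factor b i = b 0 * Ev (i - 3) * b (i - 1) / Od (i - 2)"
      using True False by (simp add: L_factor_def Ev_def Od_def)
    moreover have "L_factor b (Suc i) = Od (i - 2) * b i / (b 0 * Ev (i - 1))"
      using True False i3 by (simp add: L_factor_def Ev_def Od_def)
    ultimately show ?thesis
      unfolding Ev using b nz by (simp add: power2_eq_square)
  next
    case even: False
    then have i2: "2 \<le> i" using False i by presburger
    \<comment> \<open>For \<open>i = 2\<close> the difference \<open>i - 3\<close> truncates to
      \<open>0\<close>, which still gives the required empty range of odd indices.\<close>
    have "k = i - 1 \<or> k \<le> i - 3" if "k \<le> i - 1" "odd k" for k
      using that even i2 by presburger
    then have "{k\<in>{1..i - 1}. odd k} = insert (i - 1) {k\<in>{1..i - 3}. odd k}"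
      using even i2 by fastforce
    moreover have "i - 1 \<notin> {k\<in>{1..i - 3}. odd k}" using i2 by auto
    ultimately have Od: "Od (i - 1) = (b (i - 1))\<^sup>2 * Od (i - 3)" by (simp add: Od_def)
    have "L_factor b i = Od (i - 3) * b (i - 1) / (b 0 * Ev (i - 2))"
      using even False by (simp add: L_factor_def Ev_def Od_def)
    moreover have "L_factor b (Suc i) = b 0 * Ev (i - 2) * b i / Od (i - 1)"
      using even False i2 by (simp add: L_factor_def Ev_def Od_def)
    ultimately show ?thesis
      unfolding Od using b nz by (simp add: power2_eq_square)
  qed
qed

section \<open>Blocks of the sign sequence\<close>

lemma ell_Suc: "i < length as \<Longrightarrow> ell as (Suc i) = ell as i + as ! i"
  by (simp add: ell_def take_Suc_conv_app_nth)

lemma ell_mono: "i \<le> j \<Longrightarrow> ell as i \<le> ell as j"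
proof -
  assume "i \<le> j"
  then have "take j as = take i as @ take (j - i) (drop i as)"
    by (metis take_add le_add_diff_inverse)
  then show ?thesis by (simp add: ell_def)
qed

lemma concat_blocks:
  assumes "n \<le> length as"
  shows "length (concat (map (\<lambda>i. replicate (as ! i) (g i)) [0..<n])) = ell as n \<and>
    (\<forall>i<n. \<forall>m. ell as i \<le> m \<longrightarrow> m < ell as (Suc i) \<longrightarrow>
       concat (map (\<lambda>i. replicate (as ! i) (g i)) [0..<n]) ! m = g i)"
  using assms
proof (induction n)
  case 0
  then show ?case by (simp add: ell_def)
next
  case (Suc n)
  let ?c = "\<lambda>n. concat (map (\<lambda>i. replicate (as ! i) (g i)) [0..<n])"
  have c: "?c (Suc n) = ?c n @ replicate (as ! n) (g n)" by simp
  have IH: "length (?c n) = ell as n"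
    "\<And>i m. i < n \<Longrightarrow> ell as i \<le> m \<Longrightarrow> m < ell as (Suc i) \<Longrightarrow> ?c n ! m = g i"
    using Suc by auto
  have len: "length (?c (Suc n)) = ell as (Suc n)"
    unfolding c using IH(1) Suc.prems ell_Suc[of n as] by simp
  have "?c (Suc n) ! m = g i" if "i < Suc n" "ell as i \<le> m" "m < ell as (Suc i)" for i m
  proof (cases "i = n")
    case True
    have "\<not> m < length (?c n)" "m - length (?c n) < as ! n"
      using True that(2,3) IH(1) ell_Suc[of n as] Suc.prems by auto
    then show ?thesis unfolding c nth_append using True by simp
  next
    case False
    then have "i < n" using that by simp
    moreover have "m < length (?c n)"
      using that(3) ell_mono[of "Suc i" n as] \<open>i < n\<close> IH(1) by simp
    ultimately show ?thesis unfolding c nth_append using IH(2) that by simp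
  qed
  then show ?case using len by blast
qed

lemma tile_edge_glue:
  assumes "1 \<le> j" "j \<le> length st"
  shows "st ! (j - 1) = East \<Longrightarrow> tile_edge st (Suc j) West = tile_edge st j East"
    and "st ! (j - 1) = North \<Longrightarrow> tile_edge st (Suc j) South = tile_edge st j North"
proof -
  obtain x y where p: "tile_pos st j = (x, y)" by fastforce
  show "st ! (j - 1) = East \<Longrightarrow> tile_edge st (Suc j) West = tile_edge st j East"
    "st ! (j - 1) = North \<Longrightarrow> tile_edge st (Suc j) South = tile_edge st j North"
    using tile_pos_step[OF assms p] p by (simp_all add: tile_edge_eq)
qed

section \<open>Fans of diagonals along the arc\<close>

locale cf_arc = crossing_arc T r hs
  for T :: "('h::finite, 'v::{finite,linorder}) triangulation" and r hs +
  fixes ne :: side and as :: "nat list"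
  assumes cf: "is_cf_snake (arc_steps T r hs) ne as"
begin

abbreviation d :: nat where "d \<equiv> length hs"

text \<open>The step before the first tile is taken to be \<open>North\<close>, since \<open>e\<^sub>0\<close> is its south edge.\<close>

definition step :: "nat \<Rightarrow> side" where
  "step j = (if j = 0 then North else (st @ [ne]) ! (j - 1))"

text \<open>The labels of the tiles, continued by the weights of \<open>b\<^sub>0\<close> and \<open>b\<^sub>n\<close>.\<close>

definition diag :: "nat \<Rightarrow> 'v ratfun" where
  "diag j = (if j = 0 then wt (tile 1 West) else if j \<le> d then wt (hs ! (j - 1))
     else wt (tile d (other_ne ne)))"

definition e_wt :: "nat \<Rightarrow> 'v ratfun" where
  "e_wt j = (if j = 0 then wt (tile 1 South) else wt (tile j (step j)))"

lemma ne: "ne = North \<or> ne = East" and as_neq: "as \<noteq> []" and as_pos: "a \<in> set as \<Longrightarrow> 0 < a"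
  using cf by (auto simp: is_cf_snake_def)

lemma hs_neq: "hs \<noteq> []"
  using length_hs by auto

lemma diag_neq_0: "diag j \<noteq> 0"
  by (simp add: diag_def label_weight_neq_0)

lemma step_inner: "1 \<le> j \<Longrightarrow> j < d \<Longrightarrow> step j = st ! (j - 1)"
  using length_st by (auto simp: step_def nth_append)

lemma step_d: "step d = ne"
  using length_st length_hs by (auto simp: step_def nth_append)

lemma step_cases: "j \<le> d \<Longrightarrow> step j = North \<or> step j = East"
proof -
  assume j: "j \<le> d"
  consider "j = 0" | "j = d" | "1 \<le> j" "j < d" using j by linarith
  then show ?thesis
  proof cases
    case 3
    then show ?thesis using step_North_or_East[OF set_st 3(1)] step_inner[of j] length_st by simp
  qed (use step_d ne in \<open>auto simp: step_def\<close>)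
qed

text \<open>The triangle before crossing \<open>j\<close> has the diagonals \<open>j - 1\<close> and
  \<open>j\<close> and the glued edge as its sides; the previous step tells which of them is drawn
  where. The conventions at index \<open>0\<close> cover the first tile.\<close>

lemma SW_weights:
  assumes "1 \<le> j" "j \<le> d"
  shows "step (j - 1) = North \<Longrightarrow> wt (tile j South) = e_wt (j - 1) \<and> wt (tile j West) = diag (j - 1)"
    and "step (j - 1) = East \<Longrightarrow> wt (tile j West) = e_wt (j - 1) \<and> wt (tile j South) = diag (j - 1)"
proof -
  show "wt (tile j South) = e_wt (j - 1) \<and> wt (tile j West) = diag (j - 1)" if "step (j - 1) = North"
  proof (cases "j = 1")
    case True
    then show ?thesis by (simp add: e_wt_def diag_def)
  next
    case False
    then have i: "1 \<le> j - 1" "j - 1 < d" "Suc (j - 1) = j" "0 < j - 1" "j - 1 \<le> d"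
      using assms by auto
    then have N: "st ! (j - 1 - 1) = North" using that step_inner[OF i(1,2)] by simp
    show ?thesis
      using glue_North(2,3)[OF i(1,2) N] that i(4,5) unfolding i(3) by (simp add: e_wt_def diag_def)
  qed
  show "wt (tile j West) = e_wt (j - 1) \<and> wt (tile j South) = diag (j - 1)" if "step (j - 1) = East"
  proof (cases "j = 1")
    case True
    then show ?thesis using that by (simp add: step_def)
  next
    case False
    then have i: "1 \<le> j - 1" "j - 1 < d" "Suc (j - 1) = j" "0 < j - 1" "j - 1 \<le> d"
      using assms by auto
    then have N: "st ! (j - 1 - 1) = East" using that step_inner[OF i(1,2)] by simp
    show ?thesis
      using glue_East(2,3)[OF i(1,2) N] that i(4,5) unfolding i(3) by (simp add: e_wt_def diag_def)
  qed
qed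

text \<open>The same for the triangle after crossing \<open>j\<close>. At the last tile
  \<open>ne\<close> acts as the step, and the other northeast edge as the next diagonal.\<close>

lemma NE_weights:
  assumes "1 \<le> j" "j \<le> d"
  shows "step j = North \<Longrightarrow> wt (tile j North) = e_wt j \<and> wt (tile j East) = diag (Suc j)"
    and "step j = East \<Longrightarrow> wt (tile j East) = e_wt j \<and> wt (tile j North) = diag (Suc j)"
proof -
  show "wt (tile j North) = e_wt j \<and> wt (tile j East) = diag (Suc j)" if "step j = North"
  proof (cases "j = d")
    case True
    have o: "other_ne ne = East" and s: "step d = North"
      using that True step_d by (simp_all add: other_ne_def)
    show ?thesis unfolding True e_wt_def diag_def o s
      using hs_neq by (simp del: tile_side.simps)
  next
    case False
    then have j: "j < d" using assms by simp
    then show ?thesis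
      using that glue_North(1)[OF assms(1) j] step_inner[OF assms(1) j] assms
      by (simp add: e_wt_def diag_def del: tile_side.simps)
  qed
  show "wt (tile j East) = e_wt j \<and> wt (tile j North) = diag (Suc j)" if "step j = East"
  proof (cases "j = d")
    case True
    have o: "other_ne ne = North" and s: "step d = East"
      using that True step_d by (simp_all add: other_ne_def)
    show ?thesis unfolding True e_wt_def diag_def o s
      using hs_neq by (simp del: tile_side.simps)
  next
    case False
    then have j: "j < d" using assms by simp
    then show ?thesis
      using that glue_East(1)[OF assms(1) j] step_inner[OF assms(1) j] assms
      by (simp add: e_wt_def diag_def del: tile_side.simps)
  qed
qed

text \<open>
  Lambda lengths to the northeast corner of tile \<open>k\<close>, from the southwest corner of tile \<open>j\<close>, from
  the common endpoint of the diagonals \<open>j - 1\<close> and \<open>j\<close>, and from the other endpoint of diagonal \<open>j\<close>.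
  The values at \<open>j = k + 1\<close> make the recurrences hold there as well.
\<close>

definition len_apex :: "nat \<Rightarrow> nat \<Rightarrow> 'v ratfun" where
  "len_apex k j = (if j = Suc k then e_wt k else len_SW j k)"

definition len_center :: "nat \<Rightarrow> nat \<Rightarrow> 'v ratfun" where
  "len_center k j =
     (if j = Suc k then diag j else if step (j - 1) = North then len_NW j k else len_SE j k)"

definition len_rim :: "nat \<Rightarrow> nat \<Rightarrow> 'v ratfun" where
  "len_rim k j =
     (if j = Suc k then 0 else if step (j - 1) = North then len_SE j k else len_NW j k)"

lemma len_apex_rec:
  assumes "1 \<le> j" "j \<le> Suc k" "k \<le> d"
  shows "diag j * len_apex k j = e_wt (j - 1) * len_center k j + diag (j - 1) * len_rim k j"
proof (cases "j = Suc k")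
  case True
  then show ?thesis by (simp add: len_apex_def len_center_def len_rim_def)
next
  case False
  then have j: "j \<le> k" "j \<le> d" "j - 1 \<le> d" using assms by auto
  then have "diag j = wt (hs ! (j - 1))" using assms(1) by (simp add: diag_def)
  then show ?thesis
    using len_ptolemy[OF assms(1) j(1) assms(3)] SW_weights[OF assms(1) j(2)] False
      step_cases[OF j(3)]
    by (auto simp: len_apex_def len_center_def len_rim_def simp del: tile_side.simps)
qed

text \<open>If the step changes, the next diagonal shares the center with diagonal \<open>j\<close>,
  and the rim vertex becomes the next apex. If it repeats, the rim vertex becomes the new center and
  the old center the next apex.\<close>

lemma len_center_rec:
  assumes "1 \<le> j" "j \<le> k" "k \<le> d"
  shows "step (j - 1) \<noteq> step j \<Longrightarrow>
      len_center k (Suc j) = len_center k j \<and> len_rim k j = len_apex k (Suc j)"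
    and "step (j - 1) = step j \<Longrightarrow>
      len_center k (Suc j) = len_rim k j \<and> len_center k j = len_apex k (Suc j)"
proof -
  have j: "j \<le> d" "j - 1 \<le> d" "j \<noteq> Suc k" using assms by auto
  have N: "len_NW j k = len_apex k (Suc j) \<and> len_SE j k = len_center k (Suc j)" if s: "step j = North"
  proof (cases "j = k")
    case True
    then show ?thesis using len_last[of k] NE_weights(1)[OF assms(1) j(1) s] assms
      by (simp add: len_apex_def len_center_def del: tile_side.simps)
  next
    case False
    then have "j < k" "j < d" using assms by auto
    then show ?thesis
      using len_North[OF assms(1) _ assms(3)] step_inner[OF assms(1)] s
      by (simp add: len_apex_def len_center_def)
  qed
  have E: "len_SE j k = len_apex k (Suc j) \<and> len_NW j k = len_center k (Suc j)" if s: "step j = East"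
  proof (cases "j = k")
    case True
    then show ?thesis using len_last[of k] NE_weights(2)[OF assms(1) j(1) s] assms
      by (simp add: len_apex_def len_center_def del: tile_side.simps)
  next
    case False
    then have "j < k" "j < d" using assms by auto
    then show ?thesis
      using len_East[OF assms(1) _ assms(3)] step_inner[OF assms(1)] s
      by (simp add: len_apex_def len_center_def)
  qed
  have cr: "len_center k j = (if step (j - 1) = North then len_NW j k else len_SE j k)"
    "len_rim k j = (if step (j - 1) = North then len_SE j k else len_NW j k)"
    using j(3) by (simp_all add: len_center_def len_rim_def)
  show "len_center k (Suc j) = len_center k j \<and> len_rim k j = len_apex k (Suc j)"
    if "step (j - 1) \<noteq> step j"
    unfolding cr using N E that step_cases[OF j(1)] step_cases[OF j(2)] by auto
  show "len_center k (Suc j) = len_rim k j \<and> len_center k j = len_apex k (Suc j)"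
    if "step (j - 1) = step j"
    unfolding cr using N E that step_cases[OF j(1)] step_cases[OF j(2)] by auto
qed

lemma edge_weight_e_edge:
  assumes "j \<le> d"
  shows "edge_weight (arc_snake T r hs) (e_edge st ne j) = e_wt j"
  using edge_weight_tile[of 1 South] edge_weight_tile[of j "step j"] length_hs assms
  by (auto simp: e_edge_def e_wt_def step_def simp del: tile_side.simps)

lemma x_subsnake_len_apex:
  assumes "1 \<le> i" "i \<le> Suc k" "k \<le> d"
  shows "x_subsnake (arc_snake T r hs) ne i k = len_apex k i"
proof (cases "i = Suc k")
  case True
  \<comment> \<open>For an empty range of tiles the graph is the single edge \<open>e_k\<close>.
    Being nonempty, it must be covered, so its only matching is itself; this is why
    \<open>len_apex k (Suc k)\<close> is set to \<open>e_wt k\<close>.\<close>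
  have "steps (arc_snake T r hs) = st" by (simp add: arc_snake_def)
  moreover have "e_edge st ne k \<noteq> {}"
    using lattice_edge_nonempty[OF lattice_edge_square_edge] by (simp add: e_edge_def tile_edge_eq)
  then have "perfect_matchings {e_edge st ne k} = {{e_edge st ne k}}"
    unfolding perfect_matchings_def by (auto simp: subset_singleton_iff)
  ultimately show ?thesis
    using True edge_weight_e_edge[OF assms(3)]
    by (simp add: x_subsnake_def subsnake_def len_apex_def)
next
  case False
  then show ?thesis
    using x_subsnake_arc[of i k ne] assms by (simp add: len_apex_def len_SW_def sub_def)
qed

lemma x_curve_eq_len_apex: "x_curve T (Crossing hs) = len_apex d 1"
  using x_curve_Crossing[OF crossing] hs_neq by (simp add: len_apex_def len_SW_def sub_def)

lemma x_curve_gamma'_eq_len_center: "x_curve T (gamma' T r hs) = len_center d 1"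
  using x_curve_gamma'[OF crossing, of r] hs_neq
  by (simp add: len_center_def step_def len_NW_def sub_def)

lemma len_positive:
  assumes "1 \<le> j" "j \<le> Suc d"
  shows "len_apex d j \<in> positive_laurent" "len_center d j \<in> positive_laurent"
proof -
  have "sub j d \<noteq> []" if "j \<noteq> Suc d" using that assms by (simp add: sub_def)
  then show "len_apex d j \<in> positive_laurent" "len_center d j \<in> positive_laurent"
    using positive_laurent_lengths[of "sub j d" T] positive_laurent_label_weight(1)
    by (auto simp: len_apex_def len_center_def len_SW_def len_NW_def len_SE_def e_wt_def diag_def
        simp del: tile_side.simps)
qed

text \<open>Translation of the sign condition: signs agree inside a block where the snake graph
  turns, and change between blocks where it goes straight. The sequence starts at
  \<open>e_0\<close>, so its length exceeds the number of tiles by one.\<close>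

lemma ell_length: "ell as (length as) = Suc d"
  and same_block: "i < length as \<Longrightarrow> ell as i < j \<Longrightarrow> j < ell as (Suc i) \<Longrightarrow> step (j - 1) \<noteq> step j"
  and block_change: "Suc i < length as \<Longrightarrow> step (ell as (Suc i) - 1) = step (ell as (Suc i))"
proof -
  obtain f where f: "sign_function st f"
    "map (\<lambda>j. f (e_edge st ne j)) [0..<length st + 2] =
      concat (map (\<lambda>i. replicate (as ! i) (f (e_edge st ne 0) = even i)) [0..<length as])"
    using cf by (auto simp: is_cf_snake_def)
  let ?g = "\<lambda>i::nat. f (e_edge st ne 0) = even i"
  note blocks = concat_blocks[OF order_refl, of as ?g, folded f(2)]
  show len: "ell as (length as) = Suc d"
    using blocks length_st by simp
  have val: "f (e_edge st ne m) = ?g i" if "i < length as" "ell as i \<le> m" "m < ell as (Suc i)" for i m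
  proof -
    have "m < ell as (length as)"
      using that ell_mono[of "Suc i" "length as" as] by simp
    then have m: "m < length st + 2" using len length_st by simp
    have "map (\<lambda>j. f (e_edge st ne j)) [0..<length st + 2] ! m = ?g i"
      using blocks that by blast
    then show ?thesis using m by (simp del: upt_Suc)
  qed
  \<comment> \<open>Seen from tile \<open>j\<close>, the edge \<open>e_(j-1)\<close> is the south or
    west side and \<open>e_j\<close> the north or east side. Equal signs occur exactly for the pairs
    south, east and west, north.\<close>
  have tile_sign: "f (e_edge st ne (j - 1)) = f (e_edge st ne j) \<longleftrightarrow> step (j - 1) \<noteq> step j"
    if j: "1 \<le> j" "j \<le> d" for j
  proof -
    have s: "f (tile_edge st j North) = f (tile_edge st j West)"
      "f (tile_edge st j South) = f (tile_edge st j East)"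
      "f (tile_edge st j North) \<noteq> f (tile_edge st j South)"
      using f(1) j length_st by (auto simp: sign_function_def)
    have e: "e_edge st ne j = tile_edge st j (step j)"
      using j by (simp add: e_edge_def step_def)
    have "e_edge st ne (j - 1) = tile_edge st j (if step (j - 1) = North then South else West)"
    proof (cases "j = 1")
      case True
      then show ?thesis by (simp add: e_edge_def step_def)
    next
      case False
      then have i: "1 \<le> j - 1" "j - 1 \<le> length st" "j - 1 < d" "Suc (j - 1) = j" "j - 1 \<le> d"
        using j length_st by auto
      have "e_edge st ne (j - 1) = tile_edge st (j - 1) (step (j - 1))"
        using i by (auto simp: e_edge_def step_def)
      then show ?thesis
        using tile_edge_glue[OF i(1,2)] step_inner[OF i(1,3)] step_cases[OF i(5)] unfolding i(4)
        by auto
    qed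
    then show ?thesis
      using s e step_cases[of j] step_cases[of "j - 1"] j by auto
  qed
  show "step (j - 1) \<noteq> step j" if i: "i < length as" "ell as i < j" "j < ell as (Suc i)"
  proof -
    have "j < Suc d" using i ell_mono[of "Suc i" "length as" as] len by simp
    then show ?thesis using tile_sign[of j] val[OF i(1), of "j - 1"] val[OF i(1), of j] i by simp
  qed
  show "step (ell as (Suc i) - 1) = step (ell as (Suc i))" if i: "Suc i < length as"
  proof -
    have pos: "0 < as ! i" "0 < as ! Suc i" using as_pos i by simp_all
    have e: "ell as (Suc i) = ell as i + as ! i" "ell as (Suc (Suc i)) = ell as (Suc i) + as ! Suc i"
      using ell_Suc i by simp_all
    have "ell as (Suc (Suc i)) \<le> Suc d" using ell_mono[of "Suc (Suc i)" "length as" as] i len by simp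
    then have "1 \<le> ell as (Suc i)" "ell as (Suc i) \<le> d" using e pos by auto
    then show ?thesis
      using tile_sign[of "ell as (Suc i)"] val[of i "ell as (Suc i) - 1"]
        val[of "Suc i" "ell as (Suc i)"] i e pos by auto
  qed
qed

text \<open>Lambda length from the center of the \<open>i\<close>-th fan to the end of the arc.\<close>

definition fan_len :: "nat \<Rightarrow> 'v ratfun" where
  "fan_len i =
     (if i = 0 then len_apex d 1 else if i \<le> length as then len_center d (Suc (ell as (i - 1))) else 0)"

lemma ell_less: "i < length as \<Longrightarrow> ell as i < ell as (Suc i)"
  using ell_Suc[of i as] as_pos by simp

lemma ell_le: "i \<le> length as \<Longrightarrow> ell as i \<le> Suc d"
  using ell_mono[of i "length as" as] ell_length by simp

lemma fan_len_positive: "i \<le> length as \<Longrightarrow> fan_len i \<in> positive_laurent"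
proof (cases "i = 0")
  case True
  then show ?thesis using len_positive(1)[of 1] by (simp add: fan_len_def)
next
  case False
  assume i: "i \<le> length as"
  then have "ell as (i - 1) < ell as i" "ell as i \<le> Suc d"
    using ell_less[of "i - 1"] ell_le[of i] False by auto
  then show ?thesis
    using len_positive(2)[of "Suc (ell as (i - 1))"] False i by (simp add: fan_len_def)
qed

text \<open>The conventions for \<open>diag\<close> at \<open>0\<close> and \<open>Suc d\<close> let
  the two end edges fit the same formula as the tile labels at the ends of the blocks.\<close>

lemma b_weight_eq_diag:
  assumes "i \<le> length as"
  shows "b_weight (arc_snake T r hs) ne as i = diag (ell as i)"
proof -
  let ?G = "arc_snake T r hs"
  have G: "steps ?G = st" "num_tiles ?G = d" "tile_label ?G j = wt (hs ! (j - 1))" for j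
    using length_st by (simp_all add: arc_snake_def num_tiles_def)
  consider "i = 0" | "i = length as" "i \<noteq> 0" | "0 < i" "i < length as" using assms by linarith
  then show ?thesis
  proof cases
    case 1
    then show ?thesis
      using edge_weight_tile[of 1 West] length_hs
      by (simp add: b_weight_def G diag_def ell_def del: tile_side.simps)
  next
    case 2
    then show ?thesis
      using edge_weight_tile[of d "other_ne ne"] length_hs ell_length
      by (simp add: b_weight_def G diag_def del: tile_side.simps)
  next
    case 3
    have "ell as (i - 1) < ell as i" "ell as i < ell as (Suc i)" "ell as (Suc i) \<le> Suc d"
      using ell_less[of "i - 1"] ell_less[of i] ell_le[of "Suc i"] 3 by auto
    then show ?thesis using 3 by (simp add: b_weight_def G diag_def)
  qed
qed

lemma b_weight_neq_0: "b_weight (arc_snake T r hs) ne as i \<noteq> 0"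
proof (cases "i \<le> length as")
  case True
  then show ?thesis using b_weight_eq_diag diag_neq_0 by simp
next
  case False
  \<comment> \<open>Beyond the last index the value is an arbitrary label weight, which is still
    nonzero.\<close>
  then show ?thesis by (simp add: b_weight_def arc_snake_def label_weight_neq_0)
qed

text \<open>The endpoint \<open>k\<close> stays free: \<open>d\<close> gives the relation for the
  whole arc, \<open>ell as i - 1\<close> the one for the subgraph of the \<open>i\<close>-th
  block.\<close>

lemma fan_len_identity:
  assumes i: "1 \<le> i" "i \<le> length as" and k: "ell as i \<le> Suc k" "k \<le> d"
  defines "p \<equiv> Suc (ell as (i - 1))" and "q \<equiv> ell as i"
  shows "diag q * len_apex k p =
      diag (p - 1) * diag q * (\<Sum>j=p..q. e_wt (j - 1) / (diag (j - 1) * diag j)) * len_center k p +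
      diag (p - 1) * len_rim k q
    \<and> len_center k q = len_center k p"
proof (rule fan_identity)
  have i': "i - 1 < length as" "Suc (i - 1) = i" using i by auto
  show "p \<le> q" using ell_less[OF i'(1)] unfolding p_def q_def i'(2) by simp
  show "diag j * len_apex k j = e_wt (j - 1) * len_center k j + diag (j - 1) * len_rim k j"
    if "p \<le> j" "j \<le> q" for j
    using len_apex_rec[of j k] that k by (simp add: p_def q_def)
  show "len_center k (Suc j) = len_center k j \<and> len_rim k j = len_apex k (Suc j)"
    if "p \<le> j" "j < q" for j
    using len_center_rec(1)[of j k] same_block[OF i'(1), of j, unfolded i'(2)] that k
    by (simp add: p_def q_def)
  show "diag j \<noteq> 0" for j by (rule diag_neq_0)
qed

text \<open>Truncated just before tile \<open>q\<close>, the rim length there is \<open>0\<close>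
  and the center length is \<open>diag q\<close>. The fan identity then determines the apex length,
  which is the Laurent polynomial of the \<open>i\<close>-th subgraph.\<close>

lemma x_H_eq_sum:
  assumes i: "1 \<le> i" "i \<le> length as"
  defines "p \<equiv> Suc (ell as (i - 1))" and "q \<equiv> ell as i"
  shows "x_H (arc_snake T r hs) ne as i =
    diag (p - 1) * diag q * (\<Sum>j=p..q. e_wt (j - 1) / (diag (j - 1) * diag j))"
    (is "_ = diag (p - 1) * diag q * ?S")
proof -
  have "i - 1 < length as" "Suc (i - 1) = i" using i by auto
  then have pq: "1 \<le> p" "p \<le> q" "q \<le> Suc d" "Suc (q - 1) = q" "q - 1 \<le> d"
    using ell_less[of "i - 1"] ell_le[OF i(2)] by (auto simp: p_def q_def)
  have rim: "len_rim (q - 1) q = 0" and center: "len_center (q - 1) q = diag q"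
    using pq(4) by (simp_all add: len_rim_def len_center_def)
  have id: "diag q * len_apex (q - 1) p =
      diag (p - 1) * diag q * ?S * len_center (q - 1) p + diag (p - 1) * len_rim (q - 1) q"
    "len_center (q - 1) q = len_center (q - 1) p"
    using fan_len_identity[OF i, of "q - 1"] pq(4,5)
    unfolding p_def[symmetric] q_def[symmetric] by simp_all
  have "diag q * len_apex (q - 1) p = diag q * (diag (p - 1) * diag q * ?S)"
    unfolding id(1) rim id(2)[symmetric] center by (simp only: mult_zero_right mult_zero_left add_0_right mult_ac)
  then have "len_apex (q - 1) p = diag (p - 1) * diag q * ?S"
    using diag_neq_0[of q] mult_left_cancel by blast
  moreover have "x_H (arc_snake T r hs) ne as i = len_apex (q - 1) p"
    unfolding x_H_def using x_subsnake_len_apex[of p "q - 1"] pq by (simp add: p_def q_def)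
  ultimately show ?thesis by simp
qed

text \<open>The step repeats at tile \<open>ell as i\<close>, so the rim vertex takes over as center
  and the center of the finished fan becomes the next apex.\<close>

lemma fan_change:
  assumes i: "1 \<le> i" "i < length as"
  shows "len_center d (Suc (ell as i)) = len_rim d (ell as i)"
    and "len_apex d (Suc (ell as i)) = len_center d (Suc (ell as (i - 1)))"
proof -
  have i': "Suc (i - 1) = i" "i - 1 < length as" using i by auto
  have m: "1 \<le> ell as i" "ell as i \<le> d"
    using ell_less[OF i'(2)] ell_less[OF i(2)] ell_le[of "Suc i"] i i' by auto
  have "step (ell as i - 1) = step (ell as i)"
    using block_change[of "i - 1"] i' i by simp
  then have "len_center d (Suc (ell as i)) = len_rim d (ell as i)"
    "len_center d (ell as i) = len_apex d (Suc (ell as i))"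
    using len_center_rec(2)[OF m order_refl] by auto
  then show "len_center d (Suc (ell as i)) = len_rim d (ell as i)"
    "len_apex d (Suc (ell as i)) = len_center d (Suc (ell as (i - 1)))"
    using fan_len_identity[OF i(1) less_imp_le[OF i(2)], of d] m by auto
qed

text \<open>The sum in the fan identity is replaced by \<open>x_H\<close>. At the two ends, the
  first apex length belongs to the arc itself, and the last rim length vanishes since the last block
  ends at \<open>Suc d\<close>.\<close>

lemma fan_len_rec:
  assumes i: "1 \<le> i" "i \<le> length as"
  shows "diag (ell as i) * fan_len (i - 1) =
    x_H (arc_snake T r hs) ne as i * fan_len i + diag (ell as (i - 1)) * fan_len (Suc i)"
proof -
  have "fan_len (i - 1) = len_apex d (Suc (ell as (i - 1)))"
  proof (cases "i = 1")
    case True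
    then show ?thesis by (simp add: fan_len_def ell_def)
  next
    case False
    then have "1 \<le> i - 1" "i - 1 < length as" "i - 1 \<noteq> 0" using i by auto
    then show ?thesis
      using fan_change(2)[of "i - 1"] unfolding fan_len_def by (simp del: diff_is_0_eq)
  qed
  moreover have "fan_len (Suc i) = len_rim d (ell as i)"
  proof (cases "i = length as")
    case True
    then show ?thesis using ell_length by (simp add: fan_len_def len_rim_def)
  next
    case False
    then show ?thesis using fan_change(1)[of i] i by (simp add: fan_len_def)
  qed
  moreover have "fan_len i = len_center d (Suc (ell as (i - 1)))"
    using i by (simp add: fan_len_def)
  ultimately show ?thesis
    using fan_len_identity[OF i ell_le[OF i(2)] order_refl] x_H_eq_sum[OF i] by simp
qed

lemma cfrac_L_poly:
  assumes "1 \<le> i" "i \<le> length as"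
  shows "cfrac (map (L_poly (arc_snake T r hs) ne as) [i..<length as + 1]) =
    L_factor (b_weight (arc_snake T r hs) ne as) i * fan_len (i - 1) / fan_len i"
proof (rule cfrac_eq_ratio[OF _ _ _ _ _ _ L_poly_eq assms])
  let ?b = "b_weight (arc_snake T r hs) ne as"
  show "?b j * fan_len (j - 1) = x_H (arc_snake T r hs) ne as j * fan_len j + ?b (j - 1) * fan_len (Suc j)"
    if "1 \<le> j" "j \<le> length as" for j
    using fan_len_rec[OF that] b_weight_eq_diag[of j] b_weight_eq_diag[of "j - 1"] that by simp
  show "fan_len j \<noteq> 0" if "j \<le> length as" for j
    using fan_len_positive[OF that] by (rule positive_laurent_neq_0)
  show "fan_len (Suc (length as)) = 0" by (simp add: fan_len_def)
qed (simp_all add: b_weight_neq_0 L_factor_neq_0 L_factor_mult[OF b_weight_neq_0])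

end

theorem theorem6p3:
  fixes T :: "('h::finite, 'v::{finite,linorder}) triangulation"
    and hs :: "'h list" and r :: bool and ne :: side and as :: "nat list"
    and \<gamma> \<gamma>' :: "'h curve" and L :: "nat \<Rightarrow> 'v ratfun"
  assumes "ideal_triangulation T" and "no_self_folded T"
    and "\<gamma> = Crossing hs" and "generalized_arc T \<gamma>"
    and "is_cf_snake (steps (arc_snake T r hs)) ne as"
    and "\<gamma>' = gamma' T r hs"
    and "L = L_poly (arc_snake T r hs) ne as"
  shows "x_curve T \<gamma>' \<noteq> 0 \<and>
         (\<forall>i\<in>{2..length as}. cfrac (map L [i..<length as + 1]) \<noteq> 0) \<and>
         x_curve T \<gamma> / x_curve T \<gamma>' = cfrac (map L [1..<length as + 1]) \<and>
         (\<exists>p q. x_curve T \<gamma> = to_ratfun p \<and> x_curve T \<gamma>' = to_ratfun q \<and> rel_prime p q) \<and>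
         (expansion_formula T \<longrightarrow> is_arc T \<gamma> \<longrightarrow> is_arc T \<gamma>' \<longrightarrow>
            x_curve T \<gamma> \<in> cluster_variables T \<and> x_curve T \<gamma>' \<in> cluster_variables T)"
proof -
  interpret cf_arc T r hs ne as
    using assms by unfold_locales (simp_all add: arc_snake_def)
  let ?b = "b_weight (arc_snake T r hs) ne as"
  have n: "1 \<le> length as" using as_neq by (simp add: Suc_le_eq)
  have x: "x_curve T \<gamma> = fan_len 0" "x_curve T \<gamma>' = fan_len 1"
    using x_curve_eq_len_apex x_curve_gamma'_eq_len_center assms n
    by (simp_all add: fan_len_def ell_def)
  have nz: "fan_len i \<noteq> 0" if "i \<le> length as" for i
    using fan_len_positive[OF that] by (rule positive_laurent_neq_0)
  \<comment> \<open>The tails are the denominators of the nested fraction, so no division by zero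
    occurs. Each is a nonzero scaling factor times a quotient of two nonzero fan lengths.\<close>
  have tails: "cfrac (map L [i..<length as + 1]) \<noteq> 0" if "i \<in> {2..length as}" for i
  proof -
    have "1 \<le> i" "i \<le> length as" "i - 1 \<le> length as" using that by auto
    then show ?thesis
      using cfrac_L_poly[of i] nz[of i] nz[of "i - 1"] L_factor_neq_0[of ?b i, OF b_weight_neq_0]
        assms(7) by simp
  qed
  have frac: "x_curve T \<gamma> / x_curve T \<gamma>' = cfrac (map L [1..<length as + 1])"
    using cfrac_L_poly[OF order_refl n] x assms(7) by (simp add: L_factor_def)
  obtain p q where pq: "x_curve T \<gamma> = to_ratfun p" "x_curve T \<gamma>' = to_ratfun q"
    using fan_len_positive[of 0] fan_len_positive[of 1] n x by (auto simp: positive_laurent_def)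
  \<comment> \<open>The orientation \<open>r\<close> decides which of the two diagonal lengths
    belongs to \<open>\<gamma>'\<close>.\<close>
  have "rel_prime p q"
    using rel_prime_lengths[OF hs_neq, of T p q] pq x_curve_Crossing[OF crossing]
      x_curve_gamma'[OF crossing, of r] assms(3,6) by (cases r) auto
  then have "\<exists>p q. x_curve T \<gamma> = to_ratfun p \<and> x_curve T \<gamma>' = to_ratfun q \<and> rel_prime p q"
    using pq by blast
  moreover have "x_curve T \<gamma>' \<noteq> 0" using x(2) nz n by simp
  ultimately show ?thesis
    using tails frac unfolding expansion_formula_def by blast
qed

end
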